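(* Let $(V,b,m)$ be a weighted graph with Laplacian $L$, let $x_0\in V$, and let $(V^{\mathrm{sym}},b^{\mathrm{sym}},m^{\mathrm{sym}})$ be a weakly spherically symmetric graph with Laplacian $L^{\mathrm{sym}}$. (1) If $(V,b,m)$ has stronger (respectively, weaker) curvature growth with respect to $x_0$ than $(V^{\mathrm{sym}},b^{\mathrm{sym}},m^{\mathrm{sym}})$, then $$\lambda_0(L)\ge\lambda_0(L^{\mathrm{sym}})\qquad(\text{respectively, }\lambda_0(L)\le\lambda_0(L^{\mathrm{sym}})).$$ (2) If $(V^{\mathrm{sym}},b^{\mathrm{sym}},m^{\mathrm{sym}})$ satisfies $\sum_{r=0}^\infty\frac{V_1(r)}{\partial B(r)}=a<\infty$ (where $V_1(r)$ and $\partial B(r)$ are those of $(V^{\mathrm{sym}},b^{\mathrm{sym}},m^{\mathrm{sym}})$ with respect to its root) and $(V,b,m)$ has stronger curvature growth with respect to $x_0$ than $(V^{\mathrm{sym}},b^{\mathrm{sym}},m^{\mathrm{sym}})$, then $$\lambda_0(L)\ge\frac1a\quad\text{and}\quad\sigma(L)=\sigma_{\mathrm{disc}}(L).$$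
   Context: A weighted graph $(V,b,m)$ (with zero potential) consists of a countably infinite set $V$, a map $m:V\to(0,\infty)$ (extended to a measure by $m(U)=\sum_{x\in U}m(x)$), and a symmetric map $b:V\times V\to[0,\infty)$ with zero diagonal. Write $x\sim y$ if $b(x,y)>0$. All weighted graphs are assumed connected (any two vertices are joined by a finite path of successive neighbors) and locally finite (each vertex has only finitely many neighbors). Let $d$ be the combinatorial graph metric. For a fixed vertex $x_0$ and $r\in\mathbb{N}_0=\{0,1,2,\dots\}$ put $S_r=S_r(x_0)=\{x:d(x,x_0)=r\}$, $S_{-1}=\emptyset$, $B_r=\bigcup_{i=0}^rS_i$. For $x\in S_r$ let $\kappa_{\pm}(x)=\frac1{m(x)}\sum_{y\in S_{r\pm1}}b(x,y)$. The graph is weakly spherically symmetric with root $o$ if $\kappa_\pm$, computed with respect to $o$, depend only on $d(\cdot,o)$; then write $\kappa_\pm^{\mathrm{sym}}(r)$ for the values on $S_r(o)$. Put $V_1(r)=m(B_r)$ and $\partial B(r)=\sum_{x\in S_r}\kappa_+(x)m(x)$. $(V,b,m)$ has stronger (respectively, weaker) curvature growth with respect to $x_0\in V$ than a weakly spherically symmetric graph $(V^{\mathrm{sym}},b^{\mathrm{sym}},m^{\mathrm{sym}})$ with root $o$ if $m(x_0)=m^{\mathrm{sym}}(o)$ and, for all $r\in\mathbb{N}_0$ and $x\in S_r(x_0)\subset V$, $\kappa_+(x)\ge\kappa_+^{\mathrm{sym}}(r)$ and $\kappa_-(x)\le\kappa_-^{\mathrm{sym}}(r)$ (respectively, $\kappa_+(x)\le\kappa_+^{\mathrm{sym}}(r)$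 and $\kappa_-(x)\ge\kappa_-^{\mathrm{sym}}(r)$). On the real Hilbert space $\ell^2(V,m)$ with $\langle f,g\rangle=\sum_x f(x)g(x)m(x)$, let $Q(f,g)=\frac12\sum_{x,y}b(x,y)(f(x)-f(y))(g(x)-g(y))$ with domain $D(Q)$ equal to the closure of the finitely supported functions with respect to $\langle\cdot,\cdot\rangle+Q(\cdot,\cdot)$; the Laplacian $L$ is the associated non-negative selfadjoint operator. $\sigma(L)$ is its spectrum, $\lambda_0(L)=\inf\sigma(L)$, and $\sigma_{\mathrm{disc}}(L)$ is the set of isolated eigenvalues of finite multiplicity. *)

theory Defs
  imports "HOL-Analysis.Analysis"
begin

section \<open>Weighted graphs\<close>

text \<open>The vertex set is the type universe. Isabelle reserves \<open>o\<close> for function composition, so the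
  root of a spherically symmetric graph is called \<open>os\<close>.\<close>

locale weighted_graph =
  fixes b :: "'v \<Rightarrow> 'v \<Rightarrow> real" and m :: "'v \<Rightarrow> real"
  assumes countable_vertices: "countable (UNIV :: 'v set)"
    and infinite_vertices: "infinite (UNIV :: 'v set)"
    and m_pos: "m x > 0"
    and b_nonneg: "b x y \<ge> 0"
    and b_sym: "b x y = b y x"
    and b_diag: "b x x = 0"
    and connected_graph: "(\<lambda>u v. b u v > 0)\<^sup>*\<^sup>* x y"
    and locally_finite: "finite {y. b x y > 0}"

definition graph_dist :: "('v \<Rightarrow> 'v \<Rightarrow> real) \<Rightarrow> 'v \<Rightarrow> 'v \<Rightarrow> nat" where
  "graph_dist b x y = (LEAST n. ((\<lambda>u v. b u v > 0) ^^ n) x y)"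

text \<open>The radius is an integer, so that the sphere of radius \<open>-1\<close> is empty. In a weighted graph all
  spheres and balls are finite, so the finite sums over them below are the intended ones.\<close>

definition graph_sphere :: "('v \<Rightarrow> 'v \<Rightarrow> real) \<Rightarrow> 'v \<Rightarrow> int \<Rightarrow> 'v set" where
  "graph_sphere b x0 r = {x. int (graph_dist b x0 x) = r}"

definition graph_ball :: "('v \<Rightarrow> 'v \<Rightarrow> real) \<Rightarrow> 'v \<Rightarrow> nat \<Rightarrow> 'v set" where
  "graph_ball b x0 r = (\<Union>i\<le>r. graph_sphere b x0 (int i))"

definition kappa_plus :: "('v \<Rightarrow> 'v \<Rightarrow> real) \<Rightarrow> ('v \<Rightarrow> real) \<Rightarrow> 'v \<Rightarrow> 'v \<Rightarrow> real" where
  "kappa_plus b m x0 x =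
     1 / m x * (\<Sum>y\<in>graph_sphere b x0 (int (graph_dist b x0 x) + 1). b x y)"

definition kappa_minus :: "('v \<Rightarrow> 'v \<Rightarrow> real) \<Rightarrow> ('v \<Rightarrow> real) \<Rightarrow> 'v \<Rightarrow> 'v \<Rightarrow> real" where
  "kappa_minus b m x0 x =
     1 / m x * (\<Sum>y\<in>graph_sphere b x0 (int (graph_dist b x0 x) - 1). b x y)"

definition weakly_spherically_symmetric ::
    "('v \<Rightarrow> 'v \<Rightarrow> real) \<Rightarrow> ('v \<Rightarrow> real) \<Rightarrow> 'v \<Rightarrow> bool" where
  "weakly_spherically_symmetric b m os \<longleftrightarrow>
     (\<forall>x y. graph_dist b os x = graph_dist b os y \<longrightarrow>
        kappa_plus b m os x = kappa_plus b m os y \<and>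
        kappa_minus b m os x = kappa_minus b m os y)"

text \<open>The common values on spheres; spheres of radius \<open>r \<ge> 0\<close> are non-empty because the graph is
  infinite, connected and locally finite, so these descriptions are proper under weak spherical
  symmetry.\<close>

definition kappa_plus_sym :: "('v \<Rightarrow> 'v \<Rightarrow> real) \<Rightarrow> ('v \<Rightarrow> real) \<Rightarrow> 'v \<Rightarrow> nat \<Rightarrow> real" where
  "kappa_plus_sym b m os r = (THE k. \<forall>x\<in>graph_sphere b os (int r). kappa_plus b m os x = k)"

definition kappa_minus_sym :: "('v \<Rightarrow> 'v \<Rightarrow> real) \<Rightarrow> ('v \<Rightarrow> real) \<Rightarrow> 'v \<Rightarrow> nat \<Rightarrow> real" where
  "kappa_minus_sym b m os r = (THE k. \<forall>x\<in>graph_sphere b os (int r). kappa_minus b m os x = k)"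

definition ball_volume :: "('v \<Rightarrow> 'v \<Rightarrow> real) \<Rightarrow> ('v \<Rightarrow> real) \<Rightarrow> 'v \<Rightarrow> nat \<Rightarrow> real" where
  "ball_volume b m x0 r = (\<Sum>x\<in>graph_ball b x0 r. m x)"

definition ball_boundary :: "('v \<Rightarrow> 'v \<Rightarrow> real) \<Rightarrow> ('v \<Rightarrow> real) \<Rightarrow> 'v \<Rightarrow> nat \<Rightarrow> real" where
  "ball_boundary b m x0 r = (\<Sum>x\<in>graph_sphere b x0 (int r). kappa_plus b m x0 x * m x)"

definition stronger_curvature_growth ::
    "('v \<Rightarrow> 'v \<Rightarrow> real) \<Rightarrow> ('v \<Rightarrow> real) \<Rightarrow> 'v \<Rightarrow>
     ('w \<Rightarrow> 'w \<Rightarrow> real) \<Rightarrow> ('w \<Rightarrow> real) \<Rightarrow> 'w \<Rightarrow> bool" where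
  "stronger_curvature_growth b m x0 bs ms os \<longleftrightarrow>
     m x0 = ms os \<and>
     (\<forall>r. \<forall>x\<in>graph_sphere b x0 (int r).
        kappa_plus b m x0 x \<ge> kappa_plus_sym bs ms os r \<and>
        kappa_minus b m x0 x \<le> kappa_minus_sym bs ms os r)"

definition weaker_curvature_growth ::
    "('v \<Rightarrow> 'v \<Rightarrow> real) \<Rightarrow> ('v \<Rightarrow> real) \<Rightarrow> 'v \<Rightarrow>
     ('w \<Rightarrow> 'w \<Rightarrow> real) \<Rightarrow> ('w \<Rightarrow> real) \<Rightarrow> 'w \<Rightarrow> bool" where
  "weaker_curvature_growth b m x0 bs ms os \<longleftrightarrow>
     m x0 = ms os \<and>
     (\<forall>r. \<forall>x\<in>graph_sphere b x0 (int r).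
        kappa_plus b m x0 x \<le> kappa_plus_sym bs ms os r \<and>
        kappa_minus b m x0 x \<ge> kappa_minus_sym bs ms os r)"

section \<open>The Laplacian\<close>

definition l2 :: "('v \<Rightarrow> real) \<Rightarrow> ('v \<Rightarrow> real) set" where
  "l2 m = {f. (\<lambda>x. (f x)\<^sup>2 * m x) summable_on UNIV}"

definition l2_inner :: "('v \<Rightarrow> real) \<Rightarrow> ('v \<Rightarrow> real) \<Rightarrow> ('v \<Rightarrow> real) \<Rightarrow> real" where
  "l2_inner m f g = (\<Sum>\<^sub>\<infinity>x. f x * g x * m x)"

definition l2_norm :: "('v \<Rightarrow> real) \<Rightarrow> ('v \<Rightarrow> real) \<Rightarrow> real" where
  "l2_norm m f = sqrt (l2_inner m f f)"

definition finite_energy :: "('v \<Rightarrow> 'v \<Rightarrow> real) \<Rightarrow> ('v \<Rightarrow> real) set" where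
  "finite_energy b = {f. (\<lambda>(x, y). b x y * (f x - f y)\<^sup>2) summable_on UNIV}"

definition energy :: "('v \<Rightarrow> 'v \<Rightarrow> real) \<Rightarrow> ('v \<Rightarrow> real) \<Rightarrow> ('v \<Rightarrow> real) \<Rightarrow> real" where
  "energy b f g = 1 / 2 * (\<Sum>\<^sub>\<infinity>(x, y). b x y * (f x - f y) * (g x - g y))"

definition finitely_supported :: "('v \<Rightarrow> real) set" where
  "finitely_supported = {f. finite {x. f x \<noteq> 0}}"

text \<open>\<open>D(Q)\<close>: the closure of the finitely supported functions, inside the square-summable functions
  of finite energy, for the norm whose square is \<open>\<langle>f, f\<rangle> + Q(f, f)\<close>.\<close>

definition form_domain :: "('v \<Rightarrow> 'v \<Rightarrow> real) \<Rightarrow> ('v \<Rightarrow> real) \<Rightarrow> ('v \<Rightarrow> real) set" where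
  "form_domain b m =
     {f \<in> l2 m \<inter> finite_energy b.
        \<forall>\<epsilon>>0. \<exists>\<phi>\<in>finitely_supported.
          l2_inner m (\<lambda>x. f x - \<phi> x) (\<lambda>x. f x - \<phi> x)
            + energy b (\<lambda>x. f x - \<phi> x) (\<lambda>x. f x - \<phi> x) < \<epsilon>}"

text \<open>The operator associated with the closed form \<open>Q\<close>: \<open>f \<in> D(L)\<close> and \<open>L f = h\<close> iff
  \<open>Q(f, g) = \<langle>h, g\<rangle>\<close> for all \<open>g \<in> D(Q)\<close>. Such \<open>h\<close> is unique because \<open>D(Q)\<close> contains the finitely
  supported functions.\<close>

definition laplacian_domain :: "('v \<Rightarrow> 'v \<Rightarrow> real) \<Rightarrow> ('v \<Rightarrow> real) \<Rightarrow> ('v \<Rightarrow> real) set" where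
  "laplacian_domain b m =
     {f \<in> form_domain b m. \<exists>h\<in>l2 m. \<forall>g\<in>form_domain b m. energy b f g = l2_inner m h g}"

definition laplacian :: "('v \<Rightarrow> 'v \<Rightarrow> real) \<Rightarrow> ('v \<Rightarrow> real) \<Rightarrow> ('v \<Rightarrow> real) \<Rightarrow> 'v \<Rightarrow> real" where
  "laplacian b m f =
     (THE h. h \<in> l2 m \<and> (\<forall>g\<in>form_domain b m. energy b f g = l2_inner m h g))"

section \<open>Spectrum\<close>

text \<open>For an operator \<open>A\<close> on \<open>l2 m\<close> with domain \<open>D\<close>: \<open>\<mu>\<close> is in the resolvent set iff \<open>A - \<mu>\<close> is a
  bijection from \<open>D\<close> onto \<open>l2 m\<close> with bounded inverse. The Hilbert space is real, and so are the
  spectral values.\<close>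

definition resolvent_set ::
    "('v \<Rightarrow> real) \<Rightarrow> ('v \<Rightarrow> real) set \<Rightarrow> (('v \<Rightarrow> real) \<Rightarrow> 'v \<Rightarrow> real) \<Rightarrow> real set" where
  "resolvent_set m D A =
     {\<mu>. bij_betw (\<lambda>f x. A f x - \<mu> * f x) D (l2 m) \<and>
         (\<exists>C. \<forall>f\<in>D. l2_norm m f \<le> C * l2_norm m (\<lambda>x. A f x - \<mu> * f x))}"

definition op_spectrum ::
    "('v \<Rightarrow> real) \<Rightarrow> ('v \<Rightarrow> real) set \<Rightarrow> (('v \<Rightarrow> real) \<Rightarrow> 'v \<Rightarrow> real) \<Rightarrow> real set" where
  "op_spectrum m D A = - resolvent_set m D A"

definition op_eigenspace ::
    "('v \<Rightarrow> real) set \<Rightarrow> (('v \<Rightarrow> real) \<Rightarrow> 'v \<Rightarrow> real) \<Rightarrow> real \<Rightarrow> ('v \<Rightarrow> real) set" where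
  "op_eigenspace D A \<mu> = {f \<in> D. A f = (\<lambda>x. \<mu> * f x)}"

definition finite_dimensional :: "('v \<Rightarrow> real) set \<Rightarrow> bool" where
  "finite_dimensional E \<longleftrightarrow>
     (\<exists>F\<subseteq>E. finite F \<and> (\<forall>f\<in>E. \<exists>c. f = (\<lambda>x. \<Sum>g\<in>F. c g * g x)))"

definition op_disc_spectrum ::
    "('v \<Rightarrow> real) \<Rightarrow> ('v \<Rightarrow> real) set \<Rightarrow> (('v \<Rightarrow> real) \<Rightarrow> 'v \<Rightarrow> real) \<Rightarrow> real set" where
  "op_disc_spectrum m D A =
     {\<mu>. \<mu> isolated_in op_spectrum m D A \<and>
         (\<exists>f\<in>op_eigenspace D A \<mu>. f \<noteq> (\<lambda>x. 0)) \<and>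
         finite_dimensional (op_eigenspace D A \<mu>)}"

definition laplacian_spectrum :: "('v \<Rightarrow> 'v \<Rightarrow> real) \<Rightarrow> ('v \<Rightarrow> real) \<Rightarrow> real set" where
  "laplacian_spectrum b m = op_spectrum m (laplacian_domain b m) (laplacian b m)"

definition laplacian_disc_spectrum :: "('v \<Rightarrow> 'v \<Rightarrow> real) \<Rightarrow> ('v \<Rightarrow> real) \<Rightarrow> real set" where
  "laplacian_disc_spectrum b m = op_disc_spectrum m (laplacian_domain b m) (laplacian b m)"

text \<open>The spectrum is non-empty and bounded below by \<open>0\<close>, so this real infimum is the genuine one.\<close>

definition spectrum_bottom :: "('v \<Rightarrow> 'v \<Rightarrow> real) \<Rightarrow> ('v \<Rightarrow> real) \<Rightarrow> real" where
  "spectrum_bottom b m = Inf (laplacian_spectrum b m)"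

end

theory Submission
  imports Defs
begin

text \<open>
  All statements about the spectrum are reduced to inequalities for the quadratic form on finitely
  supported functions. By \<open>rayleigh_bound_iff\<close>, the bottom of the spectrum is the greatest \<open>\<mu>\<close> with
  \<open>\<mu> \<langle>\<phi>, \<phi>\<rangle> \<le> Q(\<phi>, \<phi>)\<close> for all finitely supported \<open>\<phi>\<close>. Below this \<open>\<mu>\<close> the form of \<open>L - \<mu>\<close> is coercive,
  so \<open>L - \<mu>\<close> is inverted by minimising a quadratic functional (\<open>weak_solution_exists\<close>). The greatest
  \<open>\<mu>\<close> itself is in the spectrum, because a bounded inverse of \<open>L - \<mu>\<close> would, through the Cauchy-Schwarz
  inequality for its form, improve the bound.

  The comparison of the two bottoms uses a positive radial function instead of heat kernels. Given
  radial curvatures, let \<open>u\<close> solve the radial eigenvalue equation at a level \<open>\<mu> \<ge> 0\<close> with \<open>u(0) = 1\<close>.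
  If \<open>\<mu>\<close> is below the bottom of the spectrum of a graph whose curvature growth is weaker than the given
  one, then \<open>u\<close> stays positive: cutting \<open>u\<close> off at the first radius where it is not positive would give
  a test function on that graph with Rayleigh quotient at most \<open>\<mu>\<close> (\<open>radial_eigenfunction_pos\<close>).
  A positive \<open>u\<close> is decreasing, hence on a graph with stronger curvature growth it is a positive
  supersolution, and Picone's inequality shows that \<open>\<mu>\<close> is a lower bound for the form there
  (\<open>rayleigh_bound_of_radial_eigenfunction\<close>). The symmetric graph is both weaker and stronger than itself, so
  both directions of the comparison are instances of \<open>spectrum_bottom_mono_radial\<close>.

  If \<open>\<Sum> V\<^sub>1(r) / \<partial>B(r) = a\<close> is finite, the tails \<open>v(r)\<close> of this series form a decreasing radial function
  with Laplacian \<open>1\<close> on the symmetric graph, and with Laplacian at least \<open>1\<close> on the graph with stronger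
  growth. Picone's inequality becomes the Hardy inequality \<open>Q(\<phi>, \<phi>) \<ge> \<Sum> \<phi>\<^sup>2 m / v\<close>. From \<open>v \<le> a\<close> follows
  the bound \<open>1 / a\<close>. From \<open>v(r) \<longlonglongrightarrow> 0\<close> it follows that, for every \<open>K\<close>, the form exceeds \<open>K\<close> off a finite
  set \<open>B\<close>. Then \<open>L - \<mu>\<close> with \<open>\<mu> < K\<close> differs from an invertible operator by an operator that only sees the
  restriction to \<open>B\<close>. The Fredholm alternative thus becomes a statement about a matrix indexed by \<open>B\<close>
  (\<open>confining_resolvent\<close>): every spectral value is an eigenvalue. Linear combinations of
  eigenfunctions with eigenvalues below \<open>K\<close> are determined by their values on \<open>B\<close>, so there are only finitely
  many such eigenvalues, each of finite multiplicity.\<close>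

section \<open>Weighted square-summable functions\<close>

text \<open>The source of the Cauchy-Schwarz inequalities for the inner product and for non-negative forms, and of
  the Euler-Lagrange estimate for almost minimal functions. The case \<open>A = 0\<close> occurs: a direction on which
  the quadratic form degenerates.\<close>

lemma discriminant_le:
  fixes A B C :: real
  assumes "\<And>t. 0 \<le> A * t\<^sup>2 + 2 * B * t + C" "0 \<le> A"
  shows "B\<^sup>2 \<le> A * C"
proof (cases "A = 0")
  case True
  have "B = 0"
  proof (rule ccontr)
    assume "B \<noteq> 0"
    then show False using assms(1)[of "- (C + 1) / (2 * B)"] True by (simp add: field_simps)
  qed
  then show ?thesis using True by simp
next
  case False
  then have "0 < A" using assms(2) by simp
  have "0 \<le> A * (A * (-B/A)\<^sup>2 + 2 * B * (-B/A) + C)"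
    using assms(1)[of "-B/A"] \<open>0 < A\<close> by (intro mult_nonneg_nonneg) auto
  also have "\<dots> = A * C - B\<^sup>2" using False by (simp add: field_simps power2_eq_square)
  finally show ?thesis by simp
qed

text \<open>The weight may vanish. This lets one set of lemmas serve for functions on vertices, with weight
  \<open>m\<close>, and for functions on pairs of vertices, with weight \<open>b\<close>.\<close>

locale nonneg_weight =
  fixes w :: "'a \<Rightarrow> real"
  assumes weight_nonneg: "0 \<le> w x"
begin

lemma l2_product_summable:
  assumes "f \<in> l2 w" "g \<in> l2 w"
  shows "(\<lambda>x. f x * g x * w x) summable_on UNIV"
proof -
  have "(\<lambda>x. (f x)\<^sup>2 * w x + (g x)\<^sup>2 * w x) summable_on UNIV"
    using assms by (intro summable_on_add) (auto simp: l2_def)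
  moreover have "norm (f x * g x * w x) \<le> (f x)\<^sup>2 * w x + (g x)\<^sup>2 * w x" for x
  proof -
    have "\<bar>f x * g x\<bar> \<le> (f x)\<^sup>2 + (g x)\<^sup>2"
      using sum_squares_bound[of "\<bar>f x\<bar>" "\<bar>g x\<bar>"] abs_ge_zero[of "f x * g x"]
      unfolding abs_mult power2_abs by linarith
    then have "\<bar>f x * g x\<bar> * w x \<le> ((f x)\<^sup>2 + (g x)\<^sup>2) * w x"
      by (rule mult_right_mono) (rule weight_nonneg)
    then show ?thesis by (simp add: abs_mult weight_nonneg distrib_right)
  qed
  ultimately have "(\<lambda>x. norm (f x * g x * w x)) summable_on UNIV"
    by (rule summable_on_comparison_test) simp_all
  then show ?thesis by (rule abs_summable_summable)
qed

lemma l2_zero [simp]: "(\<lambda>x. 0) \<in> l2 w"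
  by (simp add: l2_def)

lemma l2_mult_bounded:
  assumes "f \<in> l2 w" "\<And>x. \<bar>p x\<bar> \<le> P"
  shows "(\<lambda>x. p x * f x) \<in> l2 w"
    and "l2_inner w (\<lambda>x. p x * f x) (\<lambda>x. p x * f x) \<le> P\<^sup>2 * l2_inner w f f"
proof -
  have le: "(p x * f x)\<^sup>2 * w x \<le> P\<^sup>2 * ((f x)\<^sup>2 * w x)" for x
  proof -
    have "(p x)\<^sup>2 \<le> P\<^sup>2" using assms(2)[of x] by (simp flip: abs_le_square_iff)
    then show ?thesis
      using weight_nonneg[of x] mult_right_mono[of "(p x)\<^sup>2" "P\<^sup>2" "(f x)\<^sup>2 * w x"]
      by (simp add: power_mult_distrib mult.assoc)
  qed
  have s: "(\<lambda>x. P\<^sup>2 * ((f x)\<^sup>2 * w x)) summable_on UNIV"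
    using assms(1) by (intro summable_on_cmult_right) (simp add: l2_def)
  show *: "(\<lambda>x. p x * f x) \<in> l2 w"
    unfolding l2_def mem_Collect_eq
    by (rule summable_on_comparison_test[OF s]) (auto simp: le weight_nonneg)
  have "(\<Sum>\<^sub>\<infinity>x. (p x * f x)\<^sup>2 * w x) \<le> (\<Sum>\<^sub>\<infinity>x. P\<^sup>2 * ((f x)\<^sup>2 * w x))"
    using * s le by (intro infsum_mono) (auto simp: l2_def)
  then show "l2_inner w (\<lambda>x. p x * f x) (\<lambda>x. p x * f x) \<le> P\<^sup>2 * l2_inner w f f"
    by (simp add: l2_inner_def power2_eq_square infsum_cmult_right')
qed

lemma l2_scale: "f \<in> l2 w \<Longrightarrow> (\<lambda>x. c * f x) \<in> l2 w"
  using l2_mult_bounded(1)[of f "\<lambda>_. c" "\<bar>c\<bar>"] by simp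

lemma l2_add:
  assumes "f \<in> l2 w" "g \<in> l2 w"
  shows "(\<lambda>x. f x + g x) \<in> l2 w"
proof -
  have "(\<lambda>x. (f x)\<^sup>2 * w x + 2 * (f x * g x * w x) + (g x)\<^sup>2 * w x) summable_on UNIV"
    using assms l2_product_summable[OF assms]
    by (intro summable_on_add summable_on_cmult_right) (auto simp: l2_def)
  then show ?thesis by (simp add: l2_def power2_eq_square algebra_simps)
qed

lemma l2_diff: "f \<in> l2 w \<Longrightarrow> g \<in> l2 w \<Longrightarrow> (\<lambda>x. f x - g x) \<in> l2 w"
  using l2_add[of f "\<lambda>x. -1 * g x"] l2_scale[of g "-1"] by simp

lemma l2_inner_commute: "l2_inner w f g = l2_inner w g f"
  by (simp add: l2_inner_def mult.commute mult.left_commute)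

lemma l2_inner_add_left:
  "f \<in> l2 w \<Longrightarrow> g \<in> l2 w \<Longrightarrow> h \<in> l2 w \<Longrightarrow>
    l2_inner w (\<lambda>x. f x + g x) h = l2_inner w f h + l2_inner w g h"
  using infsum_add[OF l2_product_summable l2_product_summable, of f h g h]
  by (simp add: l2_inner_def distrib_right)

lemma l2_inner_scale_left: "l2_inner w (\<lambda>x. c * f x) h = c * l2_inner w f h"
  by (simp add: l2_inner_def infsum_cmult_right' mult.assoc)

lemma l2_inner_scale_right: "l2_inner w h (\<lambda>x. c * f x) = c * l2_inner w h f"
  by (simp add: l2_inner_commute[of h] l2_inner_scale_left)

lemma l2_inner_diff_left:
  "f \<in> l2 w \<Longrightarrow> g \<in> l2 w \<Longrightarrow> h \<in> l2 w \<Longrightarrow>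
    l2_inner w (\<lambda>x. f x - g x) h = l2_inner w f h - l2_inner w g h"
  using l2_inner_add_left[of f "\<lambda>x. -1 * g x" h] l2_scale[of g "-1"] l2_inner_scale_left[of "-1" g h]
  by simp

lemma l2_inner_add_right:
  "f \<in> l2 w \<Longrightarrow> g \<in> l2 w \<Longrightarrow> h \<in> l2 w \<Longrightarrow>
    l2_inner w h (\<lambda>x. f x + g x) = l2_inner w h f + l2_inner w h g"
  by (simp add: l2_inner_commute[of h] l2_inner_add_left)

lemma l2_inner_diff_right:
  "f \<in> l2 w \<Longrightarrow> g \<in> l2 w \<Longrightarrow> h \<in> l2 w \<Longrightarrow>
    l2_inner w h (\<lambda>x. f x - g x) = l2_inner w h f - l2_inner w h g"
  by (simp add: l2_inner_commute[of h] l2_inner_diff_left)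

lemma l2_inner_self_nonneg: "0 \<le> l2_inner w f f"
  unfolding l2_inner_def by (rule infsum_nonneg) (simp add: weight_nonneg)

lemma l2_norm_nonneg [simp]: "0 \<le> l2_norm w f"
  by (simp add: l2_norm_def l2_inner_self_nonneg)

lemma l2_norm_squared: "(l2_norm w f)\<^sup>2 = l2_inner w f f"
  by (simp add: l2_norm_def l2_inner_self_nonneg)

lemma point_mass_le:
  assumes "f \<in> l2 w"
  shows "w x * (f x)\<^sup>2 \<le> l2_inner w f f"
proof -
  have "(\<Sum>x\<in>{x}. f x * f x * w x) \<le> l2_inner w f f"
    unfolding l2_inner_def using l2_product_summable[OF assms assms]
    by (intro finite_sum_le_infsum) (auto simp: weight_nonneg)
  then show ?thesis by (simp add: power2_eq_square mult_ac)
qed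

lemma l2_inner_combination:
  assumes "f \<in> l2 w" "g \<in> l2 w"
  shows "l2_inner w (\<lambda>x. f x + t * g x) (\<lambda>x. f x + t * g x) =
    l2_inner w f f + 2 * t * l2_inner w f g + t\<^sup>2 * l2_inner w g g"
proof -
  have tg: "(\<lambda>x. t * g x) \<in> l2 w" by (rule l2_scale) fact
  have "l2_inner w (\<lambda>x. f x + t * g x) (\<lambda>x. f x + t * g x)
     = (l2_inner w f f + t * l2_inner w f g) + t * (l2_inner w g f + t * l2_inner w g g)"
    using assms tg l2_add[OF assms(1) tg]
    by (simp add: l2_inner_add_left l2_inner_add_right l2_inner_scale_left l2_inner_scale_right)
  then show ?thesis using l2_inner_commute[of g f] by (simp add: algebra_simps power2_eq_square)
qed

lemma l2_inner_combination_le: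
  assumes "f \<in> l2 w" "g \<in> l2 w"
  shows "l2_inner w (\<lambda>x. f x + t * g x) (\<lambda>x. f x + t * g x) \<le>
    2 * l2_inner w f f + 2 * t\<^sup>2 * l2_inner w g g"
  using l2_inner_self_nonneg[of "\<lambda>x. f x + - t * g x"]
  unfolding l2_inner_combination[OF assms] by (simp add: algebra_simps)

lemma cauchy_schwarz_squared:
  assumes "f \<in> l2 w" "g \<in> l2 w"
  shows "(l2_inner w f g)\<^sup>2 \<le> l2_inner w f f * l2_inner w g g"
proof -
  have "0 \<le> l2_inner w g g * t\<^sup>2 + 2 * l2_inner w f g * t + l2_inner w f f" for t
    using l2_inner_self_nonneg[of "\<lambda>x. f x + t * g x"] l2_inner_combination[OF assms, of t]
    by (simp add: algebra_simps)
  from discriminant_le[OF this l2_inner_self_nonneg] show ?thesis by (simp add: mult.commute)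
qed

lemma cauchy_schwarz:
  "f \<in> l2 w \<Longrightarrow> g \<in> l2 w \<Longrightarrow> \<bar>l2_inner w f g\<bar> \<le> l2_norm w f * l2_norm w g"
  using cauchy_schwarz_squared[of f g]
  unfolding l2_norm_def real_sqrt_mult[symmetric] by (simp add: real_le_rsqrt)

lemma l2_tendsto_inner:
  assumes "f \<in> l2 w" "g \<in> l2 w" "\<And>n. fn n \<in> l2 w" "\<And>n. gn n \<in> l2 w"
    and "(\<lambda>n. l2_inner w (\<lambda>x. f x - fn n x) (\<lambda>x. f x - fn n x)) \<longlonglongrightarrow> 0"
    and "(\<lambda>n. l2_inner w (\<lambda>x. g x - gn n x) (\<lambda>x. g x - gn n x)) \<longlonglongrightarrow> 0"
  shows "(\<lambda>n. l2_inner w (fn n) (gn n)) \<longlonglongrightarrow> l2_inner w f g"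
proof -
  let ?d = "\<lambda>n x. f x - fn n x" and ?e = "\<lambda>n x. g x - gn n x"
  have d: "?d n \<in> l2 w" and e: "?e n \<in> l2 w" for n using assms(1-4) by (auto intro: l2_diff)
  have d0: "(\<lambda>n. l2_norm w (?d n)) \<longlonglongrightarrow> 0" and e0: "(\<lambda>n. l2_norm w (?e n)) \<longlonglongrightarrow> 0"
    unfolding l2_norm_def using assms(5,6)[THEN tendsto_real_sqrt] by simp_all
  have eq: "l2_inner w (fn n) (gn n) - l2_inner w f g =
      l2_inner w (?d n) (?e n) - l2_inner w (?d n) g - l2_inner w f (?e n)" for n
    using assms(1-4) d e
    by (simp add: l2_inner_diff_left l2_inner_diff_right)
  have bound: "norm (l2_inner w (fn n) (gn n) - l2_inner w f g) \<le>
      l2_norm w (?d n) * l2_norm w (?e n) + l2_norm w (?d n) * l2_norm w g + l2_norm w f * l2_norm w (?e n)" for n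
    unfolding eq using cauchy_schwarz[OF d e, of n n] cauchy_schwarz[OF d assms(2), of n]
      cauchy_schwarz[OF assms(1) e, of n] unfolding real_norm_def by linarith
  have "(\<lambda>n. l2_norm w (?d n) * l2_norm w (?e n) + l2_norm w (?d n) * l2_norm w g + l2_norm w f * l2_norm w (?e n)) \<longlonglongrightarrow> 0"
    using tendsto_add[OF tendsto_add[OF tendsto_mult[OF d0 e0] tendsto_mult[OF d0 tendsto_const[of "l2_norm w g"]]]
        tendsto_mult[OF tendsto_const[of "l2_norm w f"] e0]] by simp
  then have "(\<lambda>n. l2_inner w (fn n) (gn n) - l2_inner w f g) \<longlonglongrightarrow> 0"
    by (rule Lim_null_comparison[OF always_eventually, rotated]) (use bound in blast)
  then show ?thesis by (simp add: LIM_zero_iff)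
qed

text \<open>Fatou's lemma for sums: the distance, restricted to a finite set, passes to the pointwise limit, and
  a finite set is all that a sum of non-negative terms is tested on. The rate \<open>e\<close> is kept explicit so
  that the lemma applies to a sequence of functions and to the sequence of their gradients alike.\<close>

lemma l2_complete:
  assumes fn: "\<And>n. fn n \<in> l2 w"
    and cauchy: "\<And>n k. l2_inner w (\<lambda>x. fn n x - fn k x) (\<lambda>x. fn n x - fn k x) \<le> e n + e k"
    and "e \<longlonglongrightarrow> 0"
    and lim: "\<And>x. (\<lambda>n. fn n x) \<longlonglongrightarrow> f x"
  shows "f \<in> l2 w" "l2_inner w (\<lambda>x. f x - fn n x) (\<lambda>x. f x - fn n x) \<le> e n"
proof -
  have fin: "(\<Sum>x\<in>F. (f x - fn n x) * (f x - fn n x) * w x) \<le> e n" if "finite F" for F n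
  proof (rule LIMSEQ_le)
    show "(\<lambda>k. \<Sum>x\<in>F. (fn k x - fn n x) * (fn k x - fn n x) * w x) \<longlonglongrightarrow>
        (\<Sum>x\<in>F. (f x - fn n x) * (f x - fn n x) * w x)"
      by (intro tendsto_intros lim)
    show "(\<lambda>k. e k + e n) \<longlonglongrightarrow> e n"
      using tendsto_add[OF assms(3) tendsto_const[of "e n"]] by simp
    show "\<exists>N. \<forall>k\<ge>N. (\<Sum>x\<in>F. (fn k x - fn n x) * (fn k x - fn n x) * w x) \<le> e k + e n"
    proof (intro exI allI impI)
      fix k
      have "(\<Sum>x\<in>F. (fn k x - fn n x) * (fn k x - fn n x) * w x)
          \<le> l2_inner w (\<lambda>x. fn k x - fn n x) (\<lambda>x. fn k x - fn n x)"
        unfolding l2_inner_def using l2_product_summable[OF l2_diff l2_diff] fn that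
        by (intro finite_sum_le_infsum) (auto simp: weight_nonneg)
      then show "(\<Sum>x\<in>F. (fn k x - fn n x) * (fn k x - fn n x) * w x) \<le> e k + e n"
        using cauchy[of k n] by linarith
    qed
  qed
  have sm: "(\<lambda>x. (f x - fn n x) * (f x - fn n x) * w x) summable_on UNIV" for n
    by (rule nonneg_bdd_above_summable_on) (auto simp: weight_nonneg intro!: bdd_aboveI fin)
  show "l2_inner w (\<lambda>x. f x - fn n x) (\<lambda>x. f x - fn n x) \<le> e n"
    unfolding l2_inner_def using sm fin by (intro infsum_le_finite_sums) auto
  have "(\<lambda>x. f x - fn n x) \<in> l2 w" for n
    using sm[of n] by (simp add: l2_def power2_eq_square)
  from l2_add[OF this[of 0] fn[of 0]] show "f \<in> l2 w" by simp
qed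

end

section \<open>The energy form and its domain\<close>

text \<open>With gradients, the energy is half of a weighted inner product on pairs of vertices, so that the
  lemmas on weighted square-summable functions apply to it.\<close>

definition grad :: "('v \<Rightarrow> real) \<Rightarrow> 'v \<times> 'v \<Rightarrow> real" where
  "grad f = (\<lambda>(x, y). f x - f y)"

lemma finite_energy_iff: "f \<in> finite_energy b \<longleftrightarrow> grad f \<in> l2 (case_prod b)"
  by (simp add: finite_energy_def l2_def grad_def case_prod_unfold mult.commute)

lemma energy_eq_l2_inner: "energy b f g = 1 / 2 * l2_inner (case_prod b) (grad f) (grad g)"
  by (simp add: energy_def l2_inner_def grad_def case_prod_unfold mult_ac)

lemma grad_combination: "grad (\<lambda>x. f x + t * g x) = (\<lambda>e. grad f e + t * grad g e)"
  by (auto simp: grad_def algebra_simps)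

lemma grad_diff: "grad (\<lambda>x. f x - g x) = (\<lambda>e. grad f e - grad g e)"
  by (auto simp: grad_def algebra_simps)

lemma infsum_eq_finite_sum:
  assumes "finite K" "\<And>x. x \<notin> K \<Longrightarrow> F x = 0"
  shows "infsum F UNIV = sum F K"
proof -
  have "infsum F UNIV = infsum F K"
    by (rule infsum_cong_neutral) (use assms in auto)
  then show ?thesis using assms(1) by simp
qed

lemma finitely_supported_combination:
  assumes "f \<in> finitely_supported" "g \<in> finitely_supported"
  shows "(\<lambda>x. f x + t * g x) \<in> finitely_supported"
proof -
  have "{x. f x + t * g x \<noteq> 0} \<subseteq> {x. f x \<noteq> 0} \<union> {x. g x \<noteq> 0}" by auto
  then show ?thesis using assms by (auto simp: finitely_supported_def intro: finite_subset)
qed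

lemma finitely_supported_zero [simp]: "(\<lambda>x. 0) \<in> finitely_supported"
  by (simp add: finitely_supported_def)

text \<open>Minimise \<open>J f = a f f - 2 l f\<close>. Along the line \<open>\<phi> + t g\<close>, the excess of \<open>J\<close> over its infimum is a
  non-negative quadratic polynomial in \<open>t\<close>, whose discriminant bounds the defect of \<open>\<phi>\<close> in the equation
  \<open>a \<phi> g = l g\<close>. No limit is taken here; convergence comes from the same estimate with
  \<open>g = \<phi> n - \<phi> k\<close>.\<close>

lemma minimizing_sequence:
  fixes a :: "('v \<Rightarrow> real) \<Rightarrow> ('v \<Rightarrow> real) \<Rightarrow> real" and l :: "('v \<Rightarrow> real) \<Rightarrow> real"
  assumes S: "(\<lambda>x. 0) \<in> S" "\<And>f g t. f \<in> S \<Longrightarrow> g \<in> S \<Longrightarrow> (\<lambda>x. f x + t * g x) \<in> S"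
    and quad: "\<And>f g t. f \<in> S \<Longrightarrow> g \<in> S \<Longrightarrow>
      a (\<lambda>x. f x + t * g x) (\<lambda>x. f x + t * g x) = a f f + 2 * t * a f g + t\<^sup>2 * a g g"
    and nonneg: "\<And>f. f \<in> S \<Longrightarrow> 0 \<le> a f f"
    and lin: "\<And>f g t. f \<in> S \<Longrightarrow> g \<in> S \<Longrightarrow> l (\<lambda>x. f x + t * g x) = l f + t * l g"
    and bound: "\<And>g. g \<in> S \<Longrightarrow> (l g)\<^sup>2 \<le> C * a g g" "0 \<le> C"
  shows "\<exists>\<phi>. \<forall>n. \<phi> n \<in> S \<and> (\<forall>g\<in>S. (a (\<phi> n) g - l g)\<^sup>2 \<le> a g g / real (Suc n))"
proof -
  define J where "J f = a f f - 2 * l f" for f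
  have lower: "- C \<le> J f" if "f \<in> S" for f
  proof -
    have "(2 * l f)\<^sup>2 \<le> (C + a f f)\<^sup>2"
      using bound(1)[OF that] zero_le_power2[of "C - a f f"] by (simp add: power2_eq_square algebra_simps)
    then have "2 * l f \<le> C + a f f"
      by (rule power2_le_imp_le) (use bound(2) nonneg[OF that] in simp)
    then show ?thesis by (simp add: J_def)
  qed
  define I where "I = Inf (J ` S)"
  have bdd: "bdd_below (J ` S)" using lower by (auto intro!: bdd_belowI[of _ "-C"])
  have I_le: "I \<le> J f" if "f \<in> S" for f
    unfolding I_def by (rule cInf_lower) (use that bdd in auto)
  have "\<exists>f\<in>S. J f < I + 1 / real (Suc n)" for n
  proof -
    have "Inf (J ` S) < I + 1 / real (Suc n)" by (simp add: I_def)
    moreover have "J ` S \<noteq> {}" using S(1) by auto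
    ultimately have "\<exists>y\<in>J ` S. y < I + 1 / real (Suc n)" by (intro cInf_lessD)
    then show ?thesis by auto
  qed
  then obtain \<phi> where \<phi>: "\<And>n. \<phi> n \<in> S" "\<And>n. J (\<phi> n) < I + 1 / real (Suc n)" by metis
  have "(a (\<phi> n) g - l g)\<^sup>2 \<le> a g g * (1 / real (Suc n))" if g: "g \<in> S" for n g
  proof (rule discriminant_le)
    fix t
    have "J (\<lambda>x. \<phi> n x + t * g x) = J (\<phi> n) + 2 * t * (a (\<phi> n) g - l g) + t\<^sup>2 * a g g"
      using quad[OF \<phi>(1) g] lin[OF \<phi>(1) g] by (simp add: J_def algebra_simps)
    moreover have "I \<le> J (\<lambda>x. \<phi> n x + t * g x)" using I_le S(2)[OF \<phi>(1) g] by blast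
    ultimately show "0 \<le> a g g * t\<^sup>2 + 2 * (a (\<phi> n) g - l g) * t + 1 / real (Suc n)"
      using \<phi>(2)[of n] by (simp add: algebra_simps)
  qed (use nonneg g in auto)
  then show ?thesis using \<phi>(1) by (intro exI[of _ \<phi>]) simp
qed

context weighted_graph
begin

sublocale vertex: nonneg_weight m
  by unfold_locales (simp add: less_imp_le m_pos)

sublocale edge: nonneg_weight "case_prod b"
  by unfold_locales (auto simp: b_nonneg)

lemma finitely_supported_l2:
  assumes "\<phi> \<in> finitely_supported" shows "\<phi> \<in> l2 m"
  using assms unfolding l2_def finitely_supported_def mem_Collect_eq
  by (auto intro!: finite_nonzero_values_imp_summable_on elim: finite_subset[rotated])

text \<open>Local finiteness of the graph enters here: only finitely many edges meet the support.\<close>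

lemma finitely_supported_finite_energy:
  assumes "\<phi> \<in> finitely_supported" shows "\<phi> \<in> finite_energy b"
proof -
  let ?K = "{x. \<phi> x \<noteq> 0}" and ?N = "\<lambda>x. {y. b x y > 0}"
  let ?F = "\<lambda>(x, y). b x y * (\<phi> x - \<phi> y)\<^sup>2"
  have "finite ?K" using assms by (simp add: finitely_supported_def)
  then have "finite ((SIGMA x:?K. ?N x) \<union> prod.swap ` (SIGMA x:?K. ?N x))"
    using locally_finite by auto
  moreover have "{e. ?F e \<noteq> 0} \<subseteq> (SIGMA x:?K. ?N x) \<union> prod.swap ` (SIGMA x:?K. ?N x)"
  proof
    fix e assume "e \<in> {e. ?F e \<noteq> 0}"
    then obtain x y where e: "e = (x, y)" and nz: "b x y \<noteq> 0" "\<phi> x \<noteq> \<phi> y" by (cases e) auto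
    then have pos: "b x y > 0" "b y x > 0" using b_nonneg[of x y] b_sym[of x y] by auto
    show "e \<in> (SIGMA x:?K. ?N x) \<union> prod.swap ` (SIGMA x:?K. ?N x)"
    proof (cases "\<phi> x = 0")
      case True
      then have "e = prod.swap (y, x)" "(y, x) \<in> (SIGMA x:?K. ?N x)" using e nz pos by auto
      then show ?thesis by blast
    next
      case False then show ?thesis using e pos by auto
    qed
  qed
  ultimately have "finite {e. ?F e \<noteq> 0}" by (rule finite_subset[rotated])
  then have "?F summable_on UNIV"
    by (auto intro!: finite_nonzero_values_imp_summable_on elim: finite_subset[rotated])
  then show ?thesis by (simp add: finite_energy_def)
qed

lemma form_domain_subset: "form_domain b m \<subseteq> l2 m \<inter> finite_energy b"
  by (auto simp: form_domain_def)

lemma energy_nonneg: "0 \<le> energy b f f"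
  by (simp add: energy_eq_l2_inner edge.l2_inner_self_nonneg)

lemma finitely_supported_form_domain:
  assumes "\<phi> \<in> finitely_supported" shows "\<phi> \<in> form_domain b m"
proof -
  have "l2_inner m (\<lambda>x. \<phi> x - \<phi> x) (\<lambda>x. \<phi> x - \<phi> x) + energy b (\<lambda>x. \<phi> x - \<phi> x) (\<lambda>x. \<phi> x - \<phi> x) = 0"
    by (simp add: l2_inner_def energy_def case_prod_unfold)
  then show ?thesis
    using assms finitely_supported_l2[OF assms] finitely_supported_finite_energy[OF assms]
    by (auto simp: form_domain_def intro!: bexI[of _ \<phi>])
qed

lemma form_domain_approx:
  assumes "f \<in> form_domain b m"
  obtains \<phi> where "\<And>n. \<phi> n \<in> finitely_supported"
    "(\<lambda>n. l2_inner m (\<lambda>x. f x - \<phi> n x) (\<lambda>x. f x - \<phi> n x)) \<longlonglongrightarrow> 0"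
    "(\<lambda>n. l2_inner (case_prod b) (\<lambda>e. grad f e - grad (\<phi> n) e) (\<lambda>e. grad f e - grad (\<phi> n) e)) \<longlonglongrightarrow> 0"
proof -
  let ?A = "\<lambda>\<phi>. l2_inner m (\<lambda>x. f x - \<phi> x) (\<lambda>x. f x - \<phi> x)"
  let ?B = "\<lambda>\<phi>. energy b (\<lambda>x. f x - \<phi> x) (\<lambda>x. f x - \<phi> x)"
  have "\<exists>\<phi>\<in>finitely_supported. ?A \<phi> + ?B \<phi> < 1 / real (Suc n)" for n
    using assms by (simp add: form_domain_def)
  then obtain \<phi> where \<phi>: "\<And>n. \<phi> n \<in> finitely_supported" "\<And>n. ?A (\<phi> n) + ?B (\<phi> n) < 1 / real (Suc n)"
    by metis
  have lim: "(\<lambda>n. c / real (Suc n)) \<longlonglongrightarrow> 0" for c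
    using LIMSEQ_Suc[OF lim_const_over_n[of c]] by simp
  have "?A (\<phi> n) \<le> 1 / real (Suc n)" for n
    using \<phi>(2)[of n] energy_nonneg[of "\<lambda>x. f x - \<phi> n x"] by linarith
  then have 1: "(\<lambda>n. ?A (\<phi> n)) \<longlonglongrightarrow> 0"
    by (intro tendsto_sandwich[OF _ _ tendsto_const lim[of 1]] always_eventually)
      (auto simp: vertex.l2_inner_self_nonneg)
  have "l2_inner (case_prod b) (grad (\<lambda>x. f x - \<phi> n x)) (grad (\<lambda>x. f x - \<phi> n x)) \<le> 2 / real (Suc n)" for n
    using \<phi>(2)[of n] vertex.l2_inner_self_nonneg[of "\<lambda>x. f x - \<phi> n x"]
    unfolding energy_eq_l2_inner by simp
  then have 2: "(\<lambda>n. l2_inner (case_prod b) (grad (\<lambda>x. f x - \<phi> n x)) (grad (\<lambda>x. f x - \<phi> n x))) \<longlonglongrightarrow> 0"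
    by (intro tendsto_sandwich[OF _ _ tendsto_const lim[of 2]] always_eventually)
      (auto simp: edge.l2_inner_self_nonneg)
  show ?thesis using that[OF \<phi>(1) 1] 2 unfolding grad_diff by blast
qed

lemma form_domainI:
  assumes "f \<in> l2 m" "f \<in> finite_energy b" "\<And>n. \<phi> n \<in> finitely_supported"
    "(\<lambda>n. l2_inner m (\<lambda>x. f x - \<phi> n x) (\<lambda>x. f x - \<phi> n x)) \<longlonglongrightarrow> 0"
    "(\<lambda>n. l2_inner (case_prod b) (\<lambda>e. grad f e - grad (\<phi> n) e) (\<lambda>e. grad f e - grad (\<phi> n) e)) \<longlonglongrightarrow> 0"
  shows "f \<in> form_domain b m"
proof -
  have "(\<lambda>n. l2_inner m (\<lambda>x. f x - \<phi> n x) (\<lambda>x. f x - \<phi> n x)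
       + energy b (\<lambda>x. f x - \<phi> n x) (\<lambda>x. f x - \<phi> n x)) \<longlonglongrightarrow> 0 + 1 / 2 * 0"
    unfolding energy_eq_l2_inner grad_diff by (intro tendsto_intros assms)
  then have ev: "\<forall>\<^sub>F n in sequentially. l2_inner m (\<lambda>x. f x - \<phi> n x) (\<lambda>x. f x - \<phi> n x)
       + energy b (\<lambda>x. f x - \<phi> n x) (\<lambda>x. f x - \<phi> n x) < \<epsilon>" if "\<epsilon> > 0" for \<epsilon>
    using order_tendstoD(2)[of _ "0 + 1 / 2 * 0" sequentially \<epsilon>] that by simp
  have "\<exists>n. l2_inner m (\<lambda>x. f x - \<phi> n x) (\<lambda>x. f x - \<phi> n x)
       + energy b (\<lambda>x. f x - \<phi> n x) (\<lambda>x. f x - \<phi> n x) < \<epsilon>" if "\<epsilon> > 0" for \<epsilon>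
    using eventually_happens'[OF sequentially_bot ev[OF that]] .
  then show ?thesis using assms(1-3) by (fastforce simp: form_domain_def)
qed

lemma form_domain_combination:
  assumes f: "f \<in> form_domain b m" and g: "g \<in> form_domain b m"
  shows "(\<lambda>x. f x + t * g x) \<in> form_domain b m"
proof -
  let ?q = "\<lambda>f. l2_inner m f f + energy b f f"
  have quasi_triangle: "?q (\<lambda>x. u x + t * v x) \<le> 2 * ?q u + 2 * t\<^sup>2 * ?q v"
    if "u \<in> l2 m \<inter> finite_energy b" "v \<in> l2 m \<inter> finite_energy b" for u v
    using vertex.l2_inner_combination_le[of u v t] edge.l2_inner_combination_le[of "grad u" "grad v" t] that
    unfolding energy_eq_l2_inner grad_combination finite_energy_iff Int_iff
    by (simp add: algebra_simps)
  have diff: "(\<lambda>x. u x - v x) \<in> l2 m \<inter> finite_energy b"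
    if "u \<in> form_domain b m" "v \<in> finitely_supported" for u v
    using that form_domain_subset finitely_supported_l2[of v] finitely_supported_finite_energy[of v]
    by (auto simp: finite_energy_iff grad_diff intro!: vertex.l2_diff edge.l2_diff)
  have approx: "\<exists>\<phi>\<in>finitely_supported. ?q (\<lambda>x. u x - \<phi> x) < \<epsilon>" if "u \<in> form_domain b m" "\<epsilon> > 0" for u \<epsilon>
    using that by (simp add: form_domain_def)
  have "\<exists>\<phi>\<in>finitely_supported. ?q (\<lambda>x. f x + t * g x - \<phi> x) < \<epsilon>" if \<epsilon>: "\<epsilon> > 0" for \<epsilon>
  proof -
    have t: "0 < t\<^sup>2 + 1" by (simp add: add_nonneg_pos)
    obtain \<phi> where \<phi>: "\<phi> \<in> finitely_supported" "?q (\<lambda>x. f x - \<phi> x) < \<epsilon> / 4"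
      using approx[OF f, of "\<epsilon> / 4"] \<epsilon> by auto
    obtain \<psi> where \<psi>: "\<psi> \<in> finitely_supported" "?q (\<lambda>x. g x - \<psi> x) < \<epsilon> / (4 * (t\<^sup>2 + 1))"
      using approx[OF g, of "\<epsilon> / (4 * (t\<^sup>2 + 1))"] \<epsilon> t by auto
    have eq: "(\<lambda>x. f x + t * g x - (\<phi> x + t * \<psi> x)) = (\<lambda>x. (f x - \<phi> x) + t * (g x - \<psi> x))"
      by (auto simp: algebra_simps)
    have "t\<^sup>2 * ?q (\<lambda>x. g x - \<psi> x) \<le> t\<^sup>2 * (\<epsilon> / (4 * (t\<^sup>2 + 1)))"
      using \<psi>(2) by (intro mult_left_mono) auto
    also have "\<dots> \<le> \<epsilon> / 4" using \<epsilon> t by (simp add: divide_simps)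
    finally have "2 * ?q (\<lambda>x. f x - \<phi> x) + 2 * t\<^sup>2 * ?q (\<lambda>x. g x - \<psi> x) < \<epsilon>"
      using \<phi>(2) by simp
    then have "?q (\<lambda>x. f x + t * g x - (\<phi> x + t * \<psi> x)) < \<epsilon>"
      unfolding eq using quasi_triangle[OF diff[OF f \<phi>(1)] diff[OF g \<psi>(1)]] by linarith
    then show ?thesis using finitely_supported_combination[OF \<phi>(1) \<psi>(1), of t]
      by (intro bexI[of _ "\<lambda>x. \<phi> x + t * \<psi> x"])
  qed
  moreover have "(\<lambda>x. f x + t * g x) \<in> l2 m \<inter> finite_energy b"
    using f g form_domain_subset unfolding Int_iff finite_energy_iff grad_combination
    by (auto intro!: vertex.l2_add vertex.l2_scale edge.l2_add edge.l2_scale simp: finite_energy_iff)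
  ultimately show ?thesis unfolding form_domain_def by blast
qed

end

section \<open>Bounded potentials and the weak equation\<close>

lemma square_diff_le: "(u - v)\<^sup>2 \<le> 2 * u\<^sup>2 + 2 * v\<^sup>2" for u v :: real
  using zero_le_power2[of "u + v"] by (simp add: power2_eq_square algebra_simps)

context weighted_graph
begin

text \<open>The form of \<open>L + p\<close>. Two potentials matter: the constant \<open>- \<mu>\<close>, and \<open>- \<mu>\<close> raised by a constant on
  a finite set.\<close>

definition schroedinger :: "('v \<Rightarrow> real) \<Rightarrow> ('v \<Rightarrow> real) \<Rightarrow> ('v \<Rightarrow> real) \<Rightarrow> real" where
  "schroedinger p f g = energy b f g + l2_inner m (\<lambda>x. p x * f x) g"

lemma form_domain_l2: "f \<in> form_domain b m \<Longrightarrow> f \<in> l2 m"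
  and form_domain_grad_l2: "f \<in> form_domain b m \<Longrightarrow> grad f \<in> l2 (case_prod b)"
  using form_domain_subset by (auto simp: finite_energy_iff)

lemma potential_l2:
  assumes "bounded (range p)" "f \<in> l2 m"
  shows "(\<lambda>x. p x * f x) \<in> l2 m"
proof -
  obtain P where "\<And>x. \<bar>p x\<bar> \<le> P" using assms(1) by (auto simp: bounded_iff)
  then show ?thesis using vertex.l2_mult_bounded(1) assms(2) by blast
qed

lemma schroedinger_commute: "schroedinger p f g = schroedinger p g f"
proof -
  have "l2_inner m (\<lambda>x. p x * f x) g = l2_inner m (\<lambda>x. p x * g x) f"
    by (simp add: l2_inner_def mult_ac)
  then show ?thesis by (simp add: schroedinger_def energy_eq_l2_inner edge.l2_inner_commute)
qed

lemma schroedinger_const: "schroedinger (\<lambda>x. c) f g = energy b f g + c * l2_inner m f g"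
  by (simp add: schroedinger_def vertex.l2_inner_scale_left)

lemma schroedinger_combination_right:
  assumes "bounded (range p)" "f \<in> form_domain b m" "g \<in> form_domain b m" "h \<in> form_domain b m"
  shows "schroedinger p h (\<lambda>x. f x + t * g x) = schroedinger p h f + t * schroedinger p h g"
proof -
  have "l2_inner m (\<lambda>x. p x * h x) (\<lambda>x. f x + t * g x) =
      l2_inner m (\<lambda>x. p x * h x) f + t * l2_inner m (\<lambda>x. p x * h x) g"
    using assms by (subst vertex.l2_inner_add_right)
      (auto intro: form_domain_l2 potential_l2 vertex.l2_scale simp: vertex.l2_inner_scale_right)
  moreover have "l2_inner (case_prod b) (grad h) (grad (\<lambda>x. f x + t * g x)) =
      l2_inner (case_prod b) (grad h) (grad f) + t * l2_inner (case_prod b) (grad h) (grad g)"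
    unfolding grad_combination using assms by (subst edge.l2_inner_add_right)
      (auto intro: form_domain_grad_l2 edge.l2_scale simp: edge.l2_inner_scale_right)
  ultimately show ?thesis by (simp add: schroedinger_def energy_eq_l2_inner algebra_simps)
qed

lemma schroedinger_combination:
  assumes "bounded (range p)" "f \<in> form_domain b m" "g \<in> form_domain b m"
  shows "schroedinger p (\<lambda>x. f x + t * g x) (\<lambda>x. f x + t * g x) =
    schroedinger p f f + 2 * t * schroedinger p f g + t\<^sup>2 * schroedinger p g g"
proof -
  let ?s = "\<lambda>x. f x + t * g x"
  have s: "?s \<in> form_domain b m" using assms by (intro form_domain_combination)
  have "schroedinger p ?s ?s = schroedinger p f ?s + t * schroedinger p g ?s"
    unfolding schroedinger_combination_right[OF assms s] by (simp add: schroedinger_commute)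
  also have "\<dots> = (schroedinger p f f + t * schroedinger p f g) + t * (schroedinger p f g + t * schroedinger p g g)"
    using assms by (simp add: schroedinger_combination_right schroedinger_commute[of p g f])
  finally show ?thesis by (simp add: algebra_simps power2_eq_square)
qed

lemma schroedinger_tendsto:
  assumes p: "bounded (range p)" and f: "f \<in> form_domain b m" and g: "g \<in> form_domain b m"
    and fn: "\<And>n. fn n \<in> form_domain b m" and gn: "\<And>n. gn n \<in> form_domain b m"
    and lim: "(\<lambda>n. l2_inner m (\<lambda>x. f x - fn n x) (\<lambda>x. f x - fn n x)) \<longlonglongrightarrow> 0"
      "(\<lambda>n. l2_inner (case_prod b) (\<lambda>e. grad f e - grad (fn n) e) (\<lambda>e. grad f e - grad (fn n) e)) \<longlonglongrightarrow> 0"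
      "(\<lambda>n. l2_inner m (\<lambda>x. g x - gn n x) (\<lambda>x. g x - gn n x)) \<longlonglongrightarrow> 0"
      "(\<lambda>n. l2_inner (case_prod b) (\<lambda>e. grad g e - grad (gn n) e) (\<lambda>e. grad g e - grad (gn n) e)) \<longlonglongrightarrow> 0"
  shows "(\<lambda>n. schroedinger p (fn n) (gn n)) \<longlonglongrightarrow> schroedinger p f g"
proof -
  obtain P where P: "\<And>x. \<bar>p x\<bar> \<le> P" using p by (auto simp: bounded_iff)
  have pl: "(\<lambda>n. l2_inner m (\<lambda>x. p x * f x - p x * fn n x) (\<lambda>x. p x * f x - p x * fn n x)) \<longlonglongrightarrow> 0"
  proof (rule tendsto_sandwich[OF _ _ tendsto_const])
    show "(\<lambda>n. P\<^sup>2 * l2_inner m (\<lambda>x. f x - fn n x) (\<lambda>x. f x - fn n x)) \<longlonglongrightarrow> 0"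
      using tendsto_mult_right_zero[OF lim(1)] .
    have "l2_inner m (\<lambda>x. p x * (f x - fn n x)) (\<lambda>x. p x * (f x - fn n x))
        \<le> P\<^sup>2 * l2_inner m (\<lambda>x. f x - fn n x) (\<lambda>x. f x - fn n x)" for n
      by (intro vertex.l2_mult_bounded(2)[OF _ P] vertex.l2_diff form_domain_l2 f fn)
    then show "\<forall>\<^sub>F n in sequentially. l2_inner m (\<lambda>x. p x * f x - p x * fn n x) (\<lambda>x. p x * f x - p x * fn n x)
        \<le> P\<^sup>2 * l2_inner m (\<lambda>x. f x - fn n x) (\<lambda>x. f x - fn n x)"
      by (simp add: right_diff_distrib)
  qed (simp add: vertex.l2_inner_self_nonneg)
  have "(\<lambda>n. l2_inner m (\<lambda>x. p x * fn n x) (gn n)) \<longlonglongrightarrow> l2_inner m (\<lambda>x. p x * f x) g"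
    using p f g fn gn by (intro vertex.l2_tendsto_inner pl lim potential_l2 form_domain_l2)
  moreover have "(\<lambda>n. l2_inner (case_prod b) (grad (fn n)) (grad (gn n))) \<longlonglongrightarrow> l2_inner (case_prod b) (grad f) (grad g)"
    using f g fn gn by (intro edge.l2_tendsto_inner lim form_domain_grad_l2)
  ultimately show ?thesis unfolding schroedinger_def energy_eq_l2_inner
    by (intro tendsto_add tendsto_mult tendsto_const)
qed

lemma schroedinger_nonneg_extend:
  assumes p: "bounded (range p)" and nonneg: "\<And>\<phi>. \<phi> \<in> finitely_supported \<Longrightarrow> 0 \<le> schroedinger p \<phi> \<phi>"
    and f: "f \<in> form_domain b m"
  shows "0 \<le> schroedinger p f f"
proof -
  obtain \<phi> where \<phi>: "\<And>n. \<phi> n \<in> finitely_supported"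
    "(\<lambda>n. l2_inner m (\<lambda>x. f x - \<phi> n x) (\<lambda>x. f x - \<phi> n x)) \<longlonglongrightarrow> 0"
    "(\<lambda>n. l2_inner (case_prod b) (\<lambda>e. grad f e - grad (\<phi> n) e) (\<lambda>e. grad f e - grad (\<phi> n) e)) \<longlonglongrightarrow> 0"
    by (rule form_domain_approx[OF f]) (rule that)
  note fs = finitely_supported_form_domain[OF \<phi>(1)]
  have "(\<lambda>n. schroedinger p (\<phi> n) (\<phi> n)) \<longlonglongrightarrow> schroedinger p f f"
    by (rule schroedinger_tendsto[OF p f f fs fs \<phi>(2,3) \<phi>(2,3)])
  then show ?thesis by (rule LIMSEQ_le_const) (use nonneg \<phi>(1) in blast)
qed

lemma weak_equation_extend:
  assumes p: "bounded (range p)" and f: "f \<in> form_domain b m" and h: "h \<in> l2 m"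
    and eq: "\<And>\<phi>. \<phi> \<in> finitely_supported \<Longrightarrow> schroedinger p f \<phi> = l2_inner m h \<phi>"
    and g: "g \<in> form_domain b m"
  shows "schroedinger p f g = l2_inner m h g"
proof -
  obtain \<phi> where \<phi>: "\<And>n. \<phi> n \<in> finitely_supported"
    "(\<lambda>n. l2_inner m (\<lambda>x. g x - \<phi> n x) (\<lambda>x. g x - \<phi> n x)) \<longlonglongrightarrow> 0"
    "(\<lambda>n. l2_inner (case_prod b) (\<lambda>e. grad g e - grad (\<phi> n) e) (\<lambda>e. grad g e - grad (\<phi> n) e)) \<longlonglongrightarrow> 0"
    by (rule form_domain_approx[OF g]) (rule that)
  have const: "(\<lambda>n. l2_inner w (\<lambda>x. u x - u x) (\<lambda>x. u x - u x)) \<longlonglongrightarrow> 0" for w u :: "'x \<Rightarrow> real"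
    by (simp add: l2_inner_def)
  have "(\<lambda>n. schroedinger p f (\<phi> n)) \<longlonglongrightarrow> schroedinger p f g"
    by (rule schroedinger_tendsto[OF p f g f finitely_supported_form_domain[OF \<phi>(1)] const const \<phi>(2,3)])
  moreover have "(\<lambda>n. l2_inner m h (\<phi> n)) \<longlonglongrightarrow> l2_inner m h g"
    by (rule vertex.l2_tendsto_inner[OF h form_domain_l2[OF g] h finitely_supported_l2[OF \<phi>(1)] const \<phi>(2)])
  ultimately show ?thesis using eq[OF \<phi>(1)] LIMSEQ_unique by auto
qed

text \<open>The Lax-Milgram theorem for the form of \<open>L + p\<close>. A minimising sequence of finitely supported functions
  is Cauchy for the form, hence, by coercivity, in \<open>l2\<close>. Since \<open>p\<close> is bounded, it is then also Cauchy
  for the energy, so the limit lies in the form domain.\<close>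

lemma weak_solution_exists:
  assumes p: "bounded (range p)" and "0 < \<delta>"
    and coercive: "\<And>\<phi>. \<phi> \<in> finitely_supported \<Longrightarrow> \<delta> * l2_inner m \<phi> \<phi> \<le> schroedinger p \<phi> \<phi>"
    and h: "h \<in> l2 m"
  shows "\<exists>f\<in>form_domain b m. \<forall>g\<in>form_domain b m. schroedinger p f g = l2_inner m h g"
proof -
  let ?a = "schroedinger p" and ?q = "\<lambda>f. l2_inner m f f" and ?r = "\<lambda>f. l2_inner (case_prod b) f f"
  have fs: "\<phi> \<in> form_domain b m" if "\<phi> \<in> finitely_supported" for \<phi>
    using that by (rule finitely_supported_form_domain)
  have a_nonneg: "0 \<le> ?a \<phi> \<phi>" if "\<phi> \<in> finitely_supported" for \<phi>
    using coercive[OF that] \<open>0 < \<delta>\<close> vertex.l2_inner_self_nonneg[of \<phi>] mult_nonneg_nonneg[of \<delta> "?q \<phi>"] by linarith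
  have bound: "(l2_inner m h g)\<^sup>2 \<le> (?q h / \<delta>) * ?a g g" if "g \<in> finitely_supported" for g
  proof -
    have "(l2_inner m h g)\<^sup>2 \<le> ?q h * ?q g"
      using vertex.cauchy_schwarz_squared[OF h finitely_supported_l2[OF that]] .
    also have "\<dots> = (?q h / \<delta>) * (\<delta> * ?q g)" using \<open>0 < \<delta>\<close> by simp
    also have "\<dots> \<le> (?q h / \<delta>) * ?a g g"
      using coercive[OF that] \<open>0 < \<delta>\<close> by (intro mult_left_mono) (auto simp: vertex.l2_inner_self_nonneg)
    finally show ?thesis .
  qed
  have "\<exists>\<phi>. \<forall>n. \<phi> n \<in> finitely_supported \<and>
      (\<forall>g\<in>finitely_supported. (?a (\<phi> n) g - l2_inner m h g)\<^sup>2 \<le> ?a g g / real (Suc n))"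
  proof (rule minimizing_sequence[OF _ _ _ _ _ bound])
    show "l2_inner m h (\<lambda>x. f x + t * g x) = l2_inner m h f + t * l2_inner m h g"
      if "f \<in> finitely_supported" "g \<in> finitely_supported" for f g t
      using that h by (subst vertex.l2_inner_add_right)
        (auto intro: vertex.l2_scale finitely_supported_l2 simp: vertex.l2_inner_scale_right)
    show "0 \<le> ?q h / \<delta>" using \<open>0 < \<delta>\<close> by (simp add: vertex.l2_inner_self_nonneg)
  qed (auto intro: finitely_supported_combination schroedinger_combination p fs a_nonneg)
  then obtain \<phi> where \<phi>: "\<And>n. \<phi> n \<in> finitely_supported"
    and almost: "\<And>n g. g \<in> finitely_supported \<Longrightarrow> (?a (\<phi> n) g - l2_inner m h g)\<^sup>2 \<le> ?a g g / real (Suc n)"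
    by metis
  let ?d = "\<lambda>n k x. \<phi> n x - \<phi> k x"
  have d_fs: "?d n k \<in> finitely_supported" for n k
    using finitely_supported_combination[OF \<phi> \<phi>, of n "-1" k] by simp
  \<comment> \<open>Both almost minimal functions solve the equation up to a small defect; testing with their
    difference measures that difference by the two defects.\<close>
  have cauchy: "?a (?d n k) (?d n k) \<le> 2 / real (Suc n) + 2 / real (Suc k)" for n k
  proof -
    let ?A = "?a (?d n k) (?d n k)"
    let ?u = "?a (\<phi> n) (?d n k) - l2_inner m h (?d n k)" and ?v = "?a (\<phi> k) (?d n k) - l2_inner m h (?d n k)"
    have "?A = ?a (?d n k) (\<phi> n) - ?a (?d n k) (\<phi> k)"
      using schroedinger_combination_right[OF p fs[OF \<phi>[of n]] fs[OF \<phi>[of k]] fs[OF d_fs[of n k]], where t = "-1"] by simp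
    then have "?A = ?u - ?v" using schroedinger_commute[of p "\<phi> n" "?d n k"]
        schroedinger_commute[of p "\<phi> k" "?d n k"] by linarith
    then have "?A\<^sup>2 = (?u - ?v)\<^sup>2" by (rule arg_cong)
    also have "\<dots> \<le> 2 * ?u\<^sup>2 + 2 * ?v\<^sup>2" by (rule square_diff_le)
    also have "\<dots> \<le> ?A * (2 / real (Suc n) + 2 / real (Suc k))"
      using almost[OF d_fs, of n n k] almost[OF d_fs, of k n k] by (simp add: algebra_simps)
    finally have "?A * ?A \<le> ?A * (2 / real (Suc n) + 2 / real (Suc k))" by (simp add: power2_eq_square)
    then show ?thesis using a_nonneg[OF d_fs, of n k]
      by (cases "?A = 0") (auto simp: mult_le_cancel_left)
  qed
  obtain P where P: "\<And>x. \<bar>p x\<bar> \<le> P" using p by (auto simp: bounded_iff)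
  have "0 \<le> P" using P[of undefined] by linarith
  define c where "c = 2 * (1 + P / \<delta>)"
  \<comment> \<open>Removing the bounded potential costs at most a multiple of the squared norm, which coercivity absorbs.\<close>
  have energy_le: "?r (grad \<psi>) \<le> c * ?a \<psi> \<psi>" and norm_le: "?q \<psi> \<le> 1 / \<delta> * ?a \<psi> \<psi>"
    if "\<psi> \<in> finitely_supported" for \<psi>
  proof -
    show q: "?q \<psi> \<le> 1 / \<delta> * ?a \<psi> \<psi>"
      using coercive[OF that] \<open>0 < \<delta>\<close> by (simp add: field_simps)
    have "- l2_inner m (\<lambda>x. p x * \<psi> x) \<psi> \<le> l2_norm m (\<lambda>x. p x * \<psi> x) * l2_norm m \<psi>"
      using vertex.cauchy_schwarz[OF potential_l2[OF p] finitely_supported_l2[OF that], of \<psi>]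
        finitely_supported_l2[OF that] by linarith
    also have "\<dots> \<le> (P * l2_norm m \<psi>) * l2_norm m \<psi>"
    proof (rule mult_right_mono)
      have "(l2_norm m (\<lambda>x. p x * \<psi> x))\<^sup>2 \<le> (P * l2_norm m \<psi>)\<^sup>2"
        using vertex.l2_mult_bounded(2)[OF finitely_supported_l2[OF that] P]
        by (simp add: power_mult_distrib vertex.l2_norm_squared)
      then show "l2_norm m (\<lambda>x. p x * \<psi> x) \<le> P * l2_norm m \<psi>"
        by (rule power2_le_imp_le) (use \<open>0 \<le> P\<close> in simp)
    qed simp
    also have "\<dots> = P * ?q \<psi>" by (simp add: vertex.l2_norm_squared[symmetric] power2_eq_square)
    also have "\<dots> \<le> P * (1 / \<delta> * ?a \<psi> \<psi>)" using q \<open>0 \<le> P\<close> by (rule mult_left_mono)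
    finally have "energy b \<psi> \<psi> \<le> (1 + P / \<delta>) * ?a \<psi> \<psi>"
      by (simp add: schroedinger_def algebra_simps)
    then show "?r (grad \<psi>) \<le> c * ?a \<psi> \<psi>" by (simp add: energy_eq_l2_inner c_def algebra_simps)
  qed
  have "0 \<le> c" using \<open>0 \<le> P\<close> \<open>0 < \<delta>\<close> by (simp add: c_def)
  have lim: "(\<lambda>n. C / real (Suc n)) \<longlonglongrightarrow> 0" for C
    using LIMSEQ_Suc[OF lim_const_over_n[of C]] by simp
  have q_cauchy: "?q (?d n k) \<le> 2 / \<delta> / real (Suc n) + 2 / \<delta> / real (Suc k)" for n k
  proof -
    have "?q (?d n k) \<le> 1 / \<delta> * (2 / real (Suc n) + 2 / real (Suc k))"
      using norm_le[OF d_fs, of n k] mult_left_mono[OF cauchy[of n k], of "1 / \<delta>"] \<open>0 < \<delta>\<close> by simp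
    then show ?thesis by (simp add: distrib_left)
  qed
  have r_cauchy: "?r (\<lambda>e. grad (\<phi> n) e - grad (\<phi> k) e) \<le> 2 * c / real (Suc n) + 2 * c / real (Suc k)" for n k
  proof -
    have "?r (grad (?d n k)) \<le> c * (2 / real (Suc n) + 2 / real (Suc k))"
      using energy_le[OF d_fs, of n k] mult_left_mono[OF cauchy[of n k] \<open>0 \<le> c\<close>] by linarith
    then show ?thesis by (simp add: distrib_left grad_diff mult.commute)
  qed
  \<comment> \<open>Vertices have positive mass, so convergence in \<open>l2\<close> forces pointwise convergence.\<close>
  have "Cauchy (\<lambda>n. \<phi> n x)" for x
  proof (rule metric_CauchyI)
    fix \<epsilon> :: real assume "0 < \<epsilon>"
    then have "0 < \<epsilon>\<^sup>2 * m x / 2" using m_pos[of x] by simp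
    from order_tendstoD(2)[OF lim[of "2 / \<delta>"] this]
    obtain N where N: "\<And>n. n \<ge> N \<Longrightarrow> 2 / \<delta> / real (Suc n) < \<epsilon>\<^sup>2 * m x / 2"
      by (auto simp: eventually_sequentially)
    have "dist (\<phi> n x) (\<phi> k x) < \<epsilon>" if "n \<ge> N" "k \<ge> N" for n k
    proof -
      have "m x * (\<phi> n x - \<phi> k x)\<^sup>2 \<le> ?q (?d n k)"
        using vertex.point_mass_le[OF finitely_supported_l2[OF d_fs], of x n k] .
      also have "\<dots> < m x * \<epsilon>\<^sup>2"
        using q_cauchy[of n k] N[OF that(1)] N[OF that(2)] by (simp add: mult.commute)
      finally have "\<bar>\<phi> n x - \<phi> k x\<bar>\<^sup>2 < \<epsilon>\<^sup>2" using m_pos[of x] by simp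
      then have "\<bar>\<phi> n x - \<phi> k x\<bar> < \<epsilon>" by (rule power2_less_imp_less) (use \<open>0 < \<epsilon>\<close> in simp)
      then show ?thesis by (simp add: dist_real_def)
    qed
    then show "\<exists>N. \<forall>n\<ge>N. \<forall>k\<ge>N. dist (\<phi> n x) (\<phi> k x) < \<epsilon>" by blast
  qed
  then obtain f where f_lim: "\<And>x. (\<lambda>n. \<phi> n x) \<longlonglongrightarrow> f x"
    unfolding Cauchy_convergent_iff convergent_def by metis
  have g_lim: "(\<lambda>n. grad (\<phi> n) e) \<longlonglongrightarrow> grad f e" for e
    unfolding grad_def by (cases e) (auto intro: tendsto_diff f_lim)
  note V = vertex.l2_complete[OF finitely_supported_l2[OF \<phi>] q_cauchy lim f_lim]
  have grad_l2: "grad (\<phi> n) \<in> l2 (case_prod b)" for n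
    using finitely_supported_finite_energy[OF \<phi>] by (simp add: finite_energy_iff)
  note E = edge.l2_complete[OF grad_l2 r_cauchy lim g_lim]
  have V0: "(\<lambda>n. l2_inner m (\<lambda>x. f x - \<phi> n x) (\<lambda>x. f x - \<phi> n x)) \<longlonglongrightarrow> 0"
    by (rule tendsto_sandwich[OF _ _ tendsto_const lim[of "2 / \<delta>"]])
      (use V(2) in \<open>auto simp: vertex.l2_inner_self_nonneg\<close>)
  have E0: "(\<lambda>n. l2_inner (case_prod b) (\<lambda>e. grad f e - grad (\<phi> n) e) (\<lambda>e. grad f e - grad (\<phi> n) e)) \<longlonglongrightarrow> 0"
    by (rule tendsto_sandwich[OF _ _ tendsto_const lim[of "2 * c"]])
      (use E(2) in \<open>auto simp: edge.l2_inner_self_nonneg\<close>)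
  have f: "f \<in> form_domain b m"
    using V(1) E(1) \<phi> V0 E0 by (intro form_domainI) (auto simp: finite_energy_iff)
  have const: "(\<lambda>n. l2_inner w (\<lambda>x. u x - u x) (\<lambda>x. u x - u x)) \<longlonglongrightarrow> 0" for w u :: "'x \<Rightarrow> real"
    by (simp add: l2_inner_def)
  have "?a f g = l2_inner m h g" if g: "g \<in> finitely_supported" for g
  proof -
    have "(\<lambda>n. ?a (\<phi> n) g) \<longlonglongrightarrow> ?a f g"
      by (rule schroedinger_tendsto[OF p f fs[OF g] fs[OF \<phi>] fs[OF g] V0 E0 const const])
    then have "(\<lambda>n. (?a (\<phi> n) g - l2_inner m h g)\<^sup>2) \<longlonglongrightarrow> (?a f g - l2_inner m h g)\<^sup>2"
      by (intro tendsto_intros)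
    moreover have "(\<lambda>n. (?a (\<phi> n) g - l2_inner m h g)\<^sup>2) \<longlonglongrightarrow> 0"
      by (rule tendsto_sandwich[OF _ _ tendsto_const lim[of "?a g g"]]) (use almost[OF g] in auto)
    ultimately have "(?a f g - l2_inner m h g)\<^sup>2 = 0" by (rule LIMSEQ_unique)
    then show ?thesis by simp
  qed
  then show ?thesis using weak_equation_extend[OF p f h] f by blast
qed

end

section \<open>The Laplacian and the bottom of its spectrum\<close>

definition rayleigh_bound :: "('v \<Rightarrow> 'v \<Rightarrow> real) \<Rightarrow> ('v \<Rightarrow> real) \<Rightarrow> real \<Rightarrow> bool" where
  "rayleigh_bound b m \<mu> \<longleftrightarrow> (\<forall>\<phi>\<in>finitely_supported. \<mu> * l2_inner m \<phi> \<phi> \<le> energy b \<phi> \<phi>)"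

context weighted_graph
begin

lemma l2_inner_finite_sum:
  assumes "finite K" "{x. \<phi> x \<noteq> 0} \<subseteq> K"
  shows "l2_inner m h \<phi> = (\<Sum>x\<in>K. h x * \<phi> x * m x)"
  unfolding l2_inner_def by (rule infsum_eq_finite_sum) (use assms in auto)

lemma l2_inner_self_eq_0:
  assumes "f \<in> l2 m" "l2_inner m f f = 0"
  shows "f = (\<lambda>x. 0)"
proof
  fix x
  have "m x * (f x)\<^sup>2 \<le> 0" using vertex.point_mass_le[OF assms(1), of x] assms(2) by simp
  then show "f x = 0" using m_pos[of x] by (simp add: mult_le_0_iff)
qed

lemma finitely_supported_point: "(\<lambda>y. if y = x then 1 else 0) \<in> finitely_supported"
  by (simp add: finitely_supported_def)

lemma l2_eqI:
  assumes "\<And>\<phi>. \<phi> \<in> form_domain b m \<Longrightarrow> l2_inner m h \<phi> = l2_inner m k \<phi>"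
  shows "h = k"
proof
  fix x
  let ?\<phi> = "\<lambda>y::'v. if y = x then 1 else 0 :: real"
  have "l2_inner m u ?\<phi> = u x * m x" for u
    by (subst l2_inner_finite_sum[of "{x}"]) auto
  then show "h x = k x"
    using assms[OF finitely_supported_form_domain[OF finitely_supported_point[of x]]] m_pos[of x] by simp
qed

lemma laplacian_eqI:
  assumes "f \<in> form_domain b m" "h \<in> l2 m" "\<And>g. g \<in> form_domain b m \<Longrightarrow> energy b f g = l2_inner m h g"
  shows "f \<in> laplacian_domain b m" "laplacian b m f = h"
proof -
  show "f \<in> laplacian_domain b m" using assms by (auto simp: laplacian_domain_def)
  show "laplacian b m f = h" unfolding laplacian_def
  proof (rule the_equality)
    fix k assume "k \<in> l2 m \<and> (\<forall>g\<in>form_domain b m. energy b f g = l2_inner m k g)"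
    then show "k = h" using assms by (intro l2_eqI) auto
  qed (use assms in auto)
qed

lemma laplacian_domain_form_domain: "f \<in> laplacian_domain b m \<Longrightarrow> f \<in> form_domain b m"
  by (simp add: laplacian_domain_def)

lemma laplacian_weak:
  assumes "f \<in> laplacian_domain b m"
  shows "laplacian b m f \<in> l2 m" "g \<in> form_domain b m \<Longrightarrow> energy b f g = l2_inner m (laplacian b m f) g"
proof -
  obtain h where h: "f \<in> form_domain b m" "h \<in> l2 m" "\<forall>g\<in>form_domain b m. energy b f g = l2_inner m h g"
    using assms by (auto simp: laplacian_domain_def)
  then have "laplacian b m f = h" by (intro laplacian_eqI) auto
  then show "laplacian b m f \<in> l2 m" "g \<in> form_domain b m \<Longrightarrow> energy b f g = l2_inner m (laplacian b m f) g"
    using h by auto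
qed

lemma laplacian_weak_schroedinger:
  assumes "bounded (range p)" "f \<in> laplacian_domain b m" "g \<in> form_domain b m"
  shows "schroedinger p f g = l2_inner m (\<lambda>x. laplacian b m f x + p x * f x) g"
  using assms laplacian_weak[OF assms(2)]
  by (subst vertex.l2_inner_add_left)
    (auto simp: schroedinger_def intro: potential_l2 form_domain_l2 laplacian_domain_form_domain)

lemma laplacian_eqI_schroedinger:
  assumes p: "bounded (range p)" and f: "f \<in> form_domain b m" and h: "h \<in> l2 m"
    and eq: "\<And>g. g \<in> form_domain b m \<Longrightarrow> schroedinger p f g = l2_inner m h g"
  shows "f \<in> laplacian_domain b m" "(\<lambda>x. laplacian b m f x + p x * f x) = h"
proof -
  have pf: "(\<lambda>x. p x * f x) \<in> l2 m" by (intro potential_l2 p form_domain_l2 f)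
  have weak: "energy b f g = l2_inner m (\<lambda>x. h x - p x * f x) g" if "g \<in> form_domain b m" for g
    using eq[OF that] by (simp add: schroedinger_def vertex.l2_inner_diff_left[OF h pf form_domain_l2[OF that]])
  note * = laplacian_eqI[OF f vertex.l2_diff[OF h pf] weak]
  show "f \<in> laplacian_domain b m" "(\<lambda>x. laplacian b m f x + p x * f x) = h"
    using * by auto
qed

lemma laplacian_combination:
  assumes f: "f \<in> laplacian_domain b m" and g: "g \<in> laplacian_domain b m"
  shows "(\<lambda>x. f x + t * g x) \<in> laplacian_domain b m"
    "laplacian b m (\<lambda>x. f x + t * g x) = (\<lambda>x. laplacian b m f x + t * laplacian b m g x)"
proof -
  let ?s = "\<lambda>x. f x + t * g x" and ?h = "\<lambda>x. laplacian b m f x + t * laplacian b m g x"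
  have fg: "f \<in> form_domain b m" "g \<in> form_domain b m"
    using f g by (auto intro: laplacian_domain_form_domain)
  have p: "bounded (range (\<lambda>x::'v. 0 :: real))" by simp
  have energy: "energy b u v = schroedinger (\<lambda>x. 0) u v" for u v
    by (simp add: schroedinger_const)
  have weak: "energy b ?s u = l2_inner m ?h u" if u: "u \<in> form_domain b m" for u
  proof -
    have "energy b ?s u = energy b f u + t * energy b g u"
      unfolding energy using schroedinger_combination_right[OF p fg u, of t]
      by (simp add: schroedinger_commute[of _ u])
    also have "\<dots> = l2_inner m ?h u"
      using laplacian_weak[OF f] laplacian_weak[OF g] u
      by (subst vertex.l2_inner_add_left)
        (auto intro: vertex.l2_scale form_domain_l2 simp: vertex.l2_inner_scale_left)
    finally show ?thesis .
  qed
  have "?h \<in> l2 m" by (intro vertex.l2_add vertex.l2_scale laplacian_weak f g)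
  note * = laplacian_eqI[OF form_domain_combination[OF fg] this weak]
  show "?s \<in> laplacian_domain b m" "laplacian b m ?s = ?h" using * by auto
qed

text \<open>The lower bound makes \<open>L - \<mu>\<close> injective, so that surjectivity is the only other obligation.\<close>

lemma resolvent_setI:
  assumes onto: "\<And>h. h \<in> l2 m \<Longrightarrow> \<exists>f\<in>laplacian_domain b m. (\<lambda>x. laplacian b m f x - \<mu> * f x) = h"
    and bound: "\<And>f. f \<in> laplacian_domain b m \<Longrightarrow>
      l2_norm m f \<le> C * l2_norm m (\<lambda>x. laplacian b m f x - \<mu> * f x)"
  shows "\<mu> \<in> resolvent_set m (laplacian_domain b m) (laplacian b m)"
proof -
  let ?T = "\<lambda>f x. laplacian b m f x - \<mu> * f x"
  have "inj_on ?T (laplacian_domain b m)"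
  proof (rule inj_onI)
    fix f g assume fg: "f \<in> laplacian_domain b m" "g \<in> laplacian_domain b m" and eq: "?T f = ?T g"
    let ?d = "\<lambda>x. f x + -1 * g x"
    note d = laplacian_combination[OF fg, of "-1"]
    have "?T ?d = (\<lambda>x. 0)" using fun_cong[OF eq] unfolding d(2) by (auto simp: algebra_simps)
    then have "l2_norm m ?d \<le> C * l2_norm m (\<lambda>x. 0)" using bound[OF d(1)] by simp
    then have "l2_norm m ?d \<le> 0" by (simp add: l2_norm_def l2_inner_def)
    then have "l2_inner m ?d ?d = 0" by (simp add: l2_norm_def vertex.l2_inner_self_nonneg antisym)
    then have "?d = (\<lambda>x. 0)"
      by (intro l2_inner_self_eq_0 form_domain_l2 laplacian_domain_form_domain d(1))
    then show "f = g" by (auto simp: fun_eq_iff)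
  qed
  moreover have "?T f \<in> l2 m" if "f \<in> laplacian_domain b m" for f
    by (intro vertex.l2_diff vertex.l2_scale laplacian_weak that form_domain_l2 laplacian_domain_form_domain)
  then have "?T ` laplacian_domain b m = l2 m" using onto by (auto simp: image_iff)
  ultimately show ?thesis using bound by (auto simp: resolvent_set_def bij_betw_def)
qed

lemma coercive_extend:
  assumes p: "bounded (range p)"
    and coercive: "\<And>\<phi>. \<phi> \<in> finitely_supported \<Longrightarrow> \<delta> * l2_inner m \<phi> \<phi> \<le> schroedinger p \<phi> \<phi>"
    and f: "f \<in> form_domain b m"
  shows "\<delta> * l2_inner m f f \<le> schroedinger p f f"
proof -
  have shift: "schroedinger (\<lambda>x. p x - \<delta>) u u = schroedinger p u u - \<delta> * l2_inner m u u"
    if "u \<in> form_domain b m" for u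
    using that p vertex.l2_inner_diff_left[of "\<lambda>x. p x * u x" "\<lambda>x. \<delta> * u x" u]
    by (simp add: schroedinger_def left_diff_distrib potential_l2 form_domain_l2 vertex.l2_scale
        vertex.l2_inner_scale_left)
  have "bounded (range (\<lambda>x. p x - \<delta>))"
    using bounded_minus_comp[OF p, of "\<lambda>_. \<delta>"] by simp
  moreover have "0 \<le> schroedinger (\<lambda>x. p x - \<delta>) \<phi> \<phi>" if "\<phi> \<in> finitely_supported" for \<phi>
    using coercive[OF that] shift[OF finitely_supported_form_domain[OF that]] by simp
  ultimately have "0 \<le> schroedinger (\<lambda>x. p x - \<delta>) f f"
    using f by (rule schroedinger_nonneg_extend)
  then show ?thesis by (simp add: shift f)
qed

lemma coercive_operator_onto:
  assumes "bounded (range p)" "0 < \<delta>"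
    and "\<And>\<phi>. \<phi> \<in> finitely_supported \<Longrightarrow> \<delta> * l2_inner m \<phi> \<phi> \<le> schroedinger p \<phi> \<phi>"
    and "h \<in> l2 m"
  shows "\<exists>f\<in>laplacian_domain b m. (\<lambda>x. laplacian b m f x + p x * f x) = h"
  using weak_solution_exists[OF assms] laplacian_eqI_schroedinger[OF assms(1) _ assms(4)] by blast

text \<open>Pair \<open>(L + p) f\<close> with \<open>f\<close>.\<close>

lemma coercive_operator_bound:
  assumes p: "bounded (range p)" and "0 < \<delta>"
    and coercive: "\<And>\<phi>. \<phi> \<in> finitely_supported \<Longrightarrow> \<delta> * l2_inner m \<phi> \<phi> \<le> schroedinger p \<phi> \<phi>"
    and f: "f \<in> laplacian_domain b m"
  shows "l2_norm m f \<le> 1 / \<delta> * l2_norm m (\<lambda>x. laplacian b m f x + p x * f x)"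
proof -
  let ?T = "\<lambda>x. laplacian b m f x + p x * f x"
  have fD: "f \<in> form_domain b m" using f by (rule laplacian_domain_form_domain)
  have T: "?T \<in> l2 m" by (intro vertex.l2_add laplacian_weak f potential_l2 p form_domain_l2 fD)
  have "\<delta> * (l2_norm m f)\<^sup>2 \<le> l2_inner m ?T f"
    using coercive_extend[OF p coercive fD] laplacian_weak_schroedinger[OF p f fD]
    by (simp add: vertex.l2_norm_squared)
  also have "\<dots> \<le> l2_norm m ?T * l2_norm m f"
    using vertex.cauchy_schwarz[OF T form_domain_l2[OF fD]] by linarith
  finally have "\<delta> * l2_norm m f * l2_norm m f \<le> l2_norm m ?T * l2_norm m f"
    by (simp add: power2_eq_square)
  then have "\<delta> * l2_norm m f \<le> l2_norm m ?T"
    using vertex.l2_norm_nonneg[of f] vertex.l2_norm_nonneg[of ?T]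
    by (cases "l2_norm m f = 0") (auto simp: mult_le_cancel_right)
  then show ?thesis using \<open>0 < \<delta>\<close> by (simp add: field_simps)
qed

lemma below_rayleigh_bound_resolvent:
  assumes "rayleigh_bound b m \<nu>" "\<mu> < \<nu>"
  shows "\<mu> \<in> resolvent_set m (laplacian_domain b m) (laplacian b m)"
proof -
  have p: "bounded (range (\<lambda>x::'v. - \<mu>))" by simp
  have coercive: "(\<nu> - \<mu>) * l2_inner m \<phi> \<phi> \<le> schroedinger (\<lambda>x. - \<mu>) \<phi> \<phi>"
    if "\<phi> \<in> finitely_supported" for \<phi>
    using assms(1) that by (auto simp: rayleigh_bound_def schroedinger_const algebra_simps)
  have "0 < \<nu> - \<mu>" using assms(2) by simp
  from coercive_operator_onto[OF p this coercive] coercive_operator_bound[OF p this coercive]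
  show ?thesis by (intro resolvent_setI[where C = "1 / (\<nu> - \<mu>)"]) auto
qed

text \<open>A non-negative form is a possibly degenerate inner product.\<close>

lemma schroedinger_cauchy_schwarz:
  assumes p: "bounded (range p)" and nonneg: "\<And>f. f \<in> form_domain b m \<Longrightarrow> 0 \<le> schroedinger p f f"
    and f: "f \<in> form_domain b m" and g: "g \<in> form_domain b m"
  shows "(schroedinger p f g)\<^sup>2 \<le> schroedinger p f f * schroedinger p g g"
proof -
  have "(schroedinger p f g)\<^sup>2 \<le> schroedinger p g g * schroedinger p f f"
  proof (rule discriminant_le)
    fix t
    have "0 \<le> schroedinger p (\<lambda>x. f x + t * g x) (\<lambda>x. f x + t * g x)"
      using f g by (intro nonneg form_domain_combination)
    then show "0 \<le> schroedinger p g g * t\<^sup>2 + 2 * schroedinger p f g * t + schroedinger p f f"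
      unfolding schroedinger_combination[OF p f g] by (simp add: algebra_simps)
  qed (use nonneg g in auto)
  then show ?thesis by (simp add: mult.commute)
qed

text \<open>Let \<open>s\<close> be the form of \<open>L - \<nu>\<close>, and suppose that \<open>L - \<nu>\<close> has an inverse of norm at most \<open>K\<close>. For
  \<open>g = (L - \<nu>)\<^sup>-\<^sup>1 \<phi>\<close> we have \<open>\<langle>\<phi>, \<phi>\<rangle> = s(g, \<phi>)\<close> and \<open>s(g, g) = \<langle>\<phi>, g\<rangle> \<le> K \<langle>\<phi>, \<phi>\<rangle>\<close>. The Cauchy-Schwarz inequality for
  \<open>s\<close> gives \<open>\<langle>\<phi>, \<phi>\<rangle> \<le> K s(\<phi>, \<phi>)\<close>, so \<open>\<nu> + 1 / K\<close> is a better bound than \<open>\<nu>\<close>.\<close>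

lemma greatest_rayleigh_bound_spectrum:
  assumes bound: "rayleigh_bound b m \<nu>" and greatest: "\<And>\<mu>. rayleigh_bound b m \<mu> \<Longrightarrow> \<mu> \<le> \<nu>"
  shows "\<nu> \<in> laplacian_spectrum b m"
proof (rule ccontr)
  assume "\<nu> \<notin> laplacian_spectrum b m"
  then have bij: "bij_betw (\<lambda>f x. laplacian b m f x - \<nu> * f x) (laplacian_domain b m) (l2 m)"
    and "\<exists>C. \<forall>f\<in>laplacian_domain b m. l2_norm m f \<le> C * l2_norm m (\<lambda>x. laplacian b m f x - \<nu> * f x)"
    by (auto simp: laplacian_spectrum_def op_spectrum_def resolvent_set_def)
  then obtain C where C: "\<And>f. f \<in> laplacian_domain b m \<Longrightarrow>
      l2_norm m f \<le> C * l2_norm m (\<lambda>x. laplacian b m f x - \<nu> * f x)" by blast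
  define K where "K = max C 1"
  have K: "0 < K" "C \<le> K" by (auto simp: K_def)
  let ?s = "schroedinger (\<lambda>x. - \<nu>)"
  have p: "bounded (range (\<lambda>x::'v. - \<nu>))" by simp
  have "0 \<le> ?s \<phi> \<phi>" if "\<phi> \<in> finitely_supported" for \<phi>
    using bound that by (simp add: rayleigh_bound_def schroedinger_const)
  then have nonneg: "0 \<le> ?s f f" if "f \<in> form_domain b m" for f
    using that by (rule schroedinger_nonneg_extend[OF p])
  have "(\<nu> + 1 / K) * l2_inner m \<phi> \<phi> \<le> energy b \<phi> \<phi>" if fs: "\<phi> \<in> finitely_supported" for \<phi>
  proof -
    have \<phi>: "\<phi> \<in> form_domain b m" "\<phi> \<in> l2 m"
      using fs by (auto intro: finitely_supported_form_domain finitely_supported_l2)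
    have "\<phi> \<in> (\<lambda>f x. laplacian b m f x - \<nu> * f x) ` laplacian_domain b m"
      using bij \<phi>(2) by (simp add: bij_betw_def)
    then obtain g where g: "g \<in> laplacian_domain b m" and eq: "(\<lambda>x. laplacian b m g x - \<nu> * g x) = \<phi>"
      by auto
    have gD: "g \<in> form_domain b m" using g by (rule laplacian_domain_form_domain)
    have weak: "?s g u = l2_inner m \<phi> u" if "u \<in> form_domain b m" for u
      using laplacian_weak_schroedinger[OF p g that] eq by simp
    have "?s g g \<le> l2_norm m \<phi> * l2_norm m g"
      using weak[OF gD] vertex.cauchy_schwarz[OF \<phi>(2) form_domain_l2[OF gD]] by linarith
    also have "\<dots> \<le> l2_norm m \<phi> * (K * l2_norm m \<phi>)"
      using C[OF g] mult_right_mono[OF K(2), of "l2_norm m \<phi>"] unfolding eq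
      by (intro mult_left_mono) auto
    also have "\<dots> = K * l2_inner m \<phi> \<phi>"
      by (simp add: vertex.l2_norm_squared[symmetric] power2_eq_square)
    finally have "?s g g * ?s \<phi> \<phi> \<le> (K * l2_inner m \<phi> \<phi>) * ?s \<phi> \<phi>"
      using nonneg[OF \<phi>(1)] by (rule mult_right_mono)
    then have "l2_inner m \<phi> \<phi> * l2_inner m \<phi> \<phi> \<le> l2_inner m \<phi> \<phi> * (K * ?s \<phi> \<phi>)"
      using schroedinger_cauchy_schwarz[OF p nonneg gD \<phi>(1)] weak[OF \<phi>(1)]
      by (simp add: power2_eq_square algebra_simps)
    then have "l2_inner m \<phi> \<phi> \<le> K * ?s \<phi> \<phi>"
      using vertex.l2_inner_self_nonneg[of \<phi>] nonneg[OF \<phi>(1)] K(1)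
      by (cases "l2_inner m \<phi> \<phi> = 0") (auto simp: mult_le_cancel_left)
    then show ?thesis using K(1) by (simp add: schroedinger_const field_simps)
  qed
  then have "rayleigh_bound b m (\<nu> + 1 / K)" by (simp add: rayleigh_bound_def)
  then show False using greatest K(1) by fastforce
qed

lemma greatest_rayleigh_bound_exists:
  "\<exists>\<nu>\<ge>0. rayleigh_bound b m \<nu> \<and> (\<forall>\<mu>. rayleigh_bound b m \<mu> \<longrightarrow> \<mu> \<le> \<nu>)"
proof -
  let ?R = "{\<mu>. rayleigh_bound b m \<mu>}"
  have zero: "0 \<in> ?R" by (simp add: rayleigh_bound_def energy_nonneg)
  have le: "\<mu> \<le> energy b \<phi> \<phi> / l2_inner m \<phi> \<phi>"
    if "\<mu> \<in> ?R" "\<phi> \<in> finitely_supported" "0 < l2_inner m \<phi> \<phi>" for \<mu> \<phi>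
    using that by (simp add: rayleigh_bound_def pos_le_divide_eq)
  let ?\<delta> = "\<lambda>y::'v. if y = undefined then 1 else 0 :: real"
  have "l2_inner m ?\<delta> ?\<delta> = m undefined"
    by (subst l2_inner_finite_sum[of "{undefined}"]) auto
  then have "0 < l2_inner m ?\<delta> ?\<delta>" by (simp add: m_pos)
  from le[OF _ finitely_supported_point this] have bdd: "bdd_above ?R" by (rule bdd_aboveI)
  have "Sup ?R * l2_inner m \<phi> \<phi> \<le> energy b \<phi> \<phi>" if "\<phi> \<in> finitely_supported" for \<phi>
  proof (cases "l2_inner m \<phi> \<phi> = 0")
    case True then show ?thesis by (simp add: energy_nonneg)
  next
    case False
    then have pos: "0 < l2_inner m \<phi> \<phi>" using vertex.l2_inner_self_nonneg[of \<phi>] by linarith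
    have "Sup ?R \<le> energy b \<phi> \<phi> / l2_inner m \<phi> \<phi>"
      using zero le[OF _ that pos] by (intro cSup_least) auto
    then show ?thesis using pos by (simp add: pos_le_divide_eq)
  qed
  then have "rayleigh_bound b m (Sup ?R)" by (simp add: rayleigh_bound_def)
  then show ?thesis using cSup_upper[OF _ bdd] zero by (intro exI[of _ "Sup ?R"]) auto
qed

text \<open>The bridge from the spectrum to finitely supported functions: the greatest Rayleigh bound is a
  spectral value, and everything below it is in the resolvent set.\<close>

lemma rayleigh_bound_iff: "rayleigh_bound b m \<mu> \<longleftrightarrow> \<mu> \<le> spectrum_bottom b m"
  and spectrum_bottom_nonneg: "0 \<le> spectrum_bottom b m"
proof -
  obtain \<nu> where \<nu>: "0 \<le> \<nu>" "rayleigh_bound b m \<nu>" "\<And>\<mu>. rayleigh_bound b m \<mu> \<Longrightarrow> \<mu> \<le> \<nu>"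
    using greatest_rayleigh_bound_exists by auto
  have "\<nu> \<in> laplacian_spectrum b m" using greatest_rayleigh_bound_spectrum[OF \<nu>(2,3)] .
  moreover have "\<nu> \<le> \<mu>" if "\<mu> \<in> laplacian_spectrum b m" for \<mu>
    using that below_rayleigh_bound_resolvent[OF \<nu>(2), of \<mu>]
    by (auto simp: laplacian_spectrum_def op_spectrum_def not_less[symmetric])
  ultimately have eq: "spectrum_bottom b m = \<nu>"
    unfolding spectrum_bottom_def by (rule cInf_eq_minimum)
  have "rayleigh_bound b m \<mu>" if "\<mu> \<le> \<nu>" for \<mu>
    unfolding rayleigh_bound_def
  proof
    fix \<phi> :: "'v \<Rightarrow> real" assume "\<phi> \<in> finitely_supported"
    then have "\<nu> * l2_inner m \<phi> \<phi> \<le> energy b \<phi> \<phi>" using \<nu>(2) by (simp add: rayleigh_bound_def)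
    then show "\<mu> * l2_inner m \<phi> \<phi> \<le> energy b \<phi> \<phi>"
      using mult_right_mono[OF that vertex.l2_inner_self_nonneg[of \<phi>]] by linarith
  qed
  then show "rayleigh_bound b m \<mu> \<longleftrightarrow> \<mu> \<le> spectrum_bottom b m" using eq \<nu>(3) by auto
  show "0 \<le> spectrum_bottom b m" using eq \<nu>(1) by simp
qed

end

section \<open>Green's formula and Picone's inequality\<close>

text \<open>The formal Laplacian of \<open>f\<close> at \<open>x\<close>, multiplied by \<open>m x\<close>.\<close>

definition outflow :: "('v \<Rightarrow> 'v \<Rightarrow> real) \<Rightarrow> ('v \<Rightarrow> real) \<Rightarrow> 'v \<Rightarrow> real" where
  "outflow b f x = (\<Sum>y | b x y > 0. b x y * (f x - f y))"

definition closed_nbhd :: "('v \<Rightarrow> 'v \<Rightarrow> real) \<Rightarrow> 'v set \<Rightarrow> 'v set" where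
  "closed_nbhd b K = K \<union> (\<Union>x\<in>K. {y. b x y > 0})"

text \<open>The difference of the two sides is \<open>(t p - s q)\<^sup>2 / (s t)\<close>.\<close>

lemma picone_pointwise:
  fixes p q s t :: real
  assumes "0 < s" "0 < t"
  shows "(s - t) * (p\<^sup>2 / s - q\<^sup>2 / t) \<le> (p - q)\<^sup>2"
proof -
  have "(p - q)\<^sup>2 - (s - t) * (p\<^sup>2 / s - q\<^sup>2 / t) = (t * p - s * q)\<^sup>2 / (s * t)"
    using assms by (simp add: field_simps power2_eq_square)
  moreover have "0 \<le> (t * p - s * q)\<^sup>2 / (s * t)" using assms by simp
  ultimately show ?thesis by linarith
qed

context weighted_graph
begin

lemma finite_closed_nbhd: "finite K \<Longrightarrow> finite (closed_nbhd b K)"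
  by (simp add: closed_nbhd_def locally_finite)

text \<open>An edge along which \<open>\<phi>\<close> changes has an endpoint in \<open>K\<close>, hence both endpoints in its closed neighbourhood.\<close>

lemma energy_finite_sum:
  assumes "finite K" and supp: "{x. \<phi> x \<noteq> 0} \<subseteq> K"
  shows "energy b f \<phi> =
    1 / 2 * (\<Sum>x\<in>closed_nbhd b K. \<Sum>y\<in>closed_nbhd b K. b x y * (f x - f y) * (\<phi> x - \<phi> y))"
proof -
  let ?N = "closed_nbhd b K" and ?F = "\<lambda>(x, y). b x y * (f x - f y) * (\<phi> x - \<phi> y)"
  have "?F e = 0" if "e \<notin> ?N \<times> ?N" for e
  proof -
    obtain x y where e: "e = (x, y)" by (cases e)
    have "b x y = 0" if "\<phi> x \<noteq> \<phi> y"
    proof (rule ccontr)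
      assume "b x y \<noteq> 0"
      then have "b x y > 0" "b y x > 0" using b_nonneg[of x y] b_sym[of x y] by auto
      moreover have "x \<in> K \<or> y \<in> K" using that supp by (cases "\<phi> x = 0") auto
      ultimately have "x \<in> ?N \<and> y \<in> ?N" by (auto simp: closed_nbhd_def)
      then show False using \<open>e \<notin> ?N \<times> ?N\<close> e by simp
    qed
    then show ?thesis by (auto simp: e)
  qed
  then have "infsum ?F UNIV = sum ?F (?N \<times> ?N)"
    using finite_closed_nbhd[OF assms(1)] by (intro infsum_eq_finite_sum) auto
  then show ?thesis by (simp add: energy_def sum.cartesian_product)
qed

lemma energy_green:
  assumes "finite K" and supp: "{x. \<phi> x \<noteq> 0} \<subseteq> K"
  shows "energy b f \<phi> = (\<Sum>x\<in>K. \<phi> x * outflow b f x)"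
proof -
  let ?N = "closed_nbhd b K"
  let ?G = "\<lambda>x y. \<phi> x * (b x y * (f x - f y))"
  have fin: "finite ?N" by (rule finite_closed_nbhd) fact
  have "(\<Sum>x\<in>?N. \<Sum>y\<in>?N. b x y * (f x - f y) * (\<phi> x - \<phi> y))
      = (\<Sum>x\<in>?N. \<Sum>y\<in>?N. ?G x y) + (\<Sum>x\<in>?N. \<Sum>y\<in>?N. ?G y x)"
    unfolding sum.distrib[symmetric]
  proof (intro sum.cong refl)
    fix x y
    show "b x y * (f x - f y) * (\<phi> x - \<phi> y) = ?G x y + ?G y x"
      using b_sym[of x y] by (simp add: algebra_simps)
  qed
  also have "(\<Sum>x\<in>?N. \<Sum>y\<in>?N. ?G y x) = (\<Sum>x\<in>?N. \<Sum>y\<in>?N. ?G x y)"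
    by (rule sum.swap)
  finally have "energy b f \<phi> = (\<Sum>x\<in>?N. \<Sum>y\<in>?N. ?G x y)"
    using energy_finite_sum[OF assms, of f] by simp
  also have "\<dots> = (\<Sum>x\<in>?N. \<phi> x * (\<Sum>y\<in>?N. b x y * (f x - f y)))"
    by (simp add: sum_distrib_left)
  also have "\<dots> = (\<Sum>x\<in>K. \<phi> x * (\<Sum>y\<in>?N. b x y * (f x - f y)))"
    using fin supp by (intro sum.mono_neutral_right) (auto simp: closed_nbhd_def)
  also have "\<dots> = (\<Sum>x\<in>K. \<phi> x * outflow b f x)"
  proof (intro sum.cong refl arg_cong2[where f = "(*)"])
    fix x assume "x \<in> K"
    then show "(\<Sum>y\<in>?N. b x y * (f x - f y)) = outflow b f x"
      unfolding outflow_def using fin b_nonneg[of x]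
      by (intro sum.mono_neutral_right) (auto simp: closed_nbhd_def order.antisym_conv2 less_le)
  qed
  finally show ?thesis .
qed

text \<open>Green's formula for \<open>u\<close> with the test function \<open>\<phi>\<^sup>2 / u\<close>, followed by the pointwise inequality on each
  edge. A positive function \<open>u\<close> whose Laplacian dominates \<open>W u\<close> thus bounds the energy of \<open>\<phi>\<close> below by
  \<open>\<Sum> W \<phi>\<^sup>2 m\<close>.\<close>

lemma picone_inequality:
  assumes u: "\<And>x. 0 < u x" and "finite K" and supp: "{x. \<phi> x \<noteq> 0} \<subseteq> K"
  shows "(\<Sum>x\<in>K. (\<phi> x)\<^sup>2 / u x * outflow b u x) \<le> energy b \<phi> \<phi>"
proof -
  have supp': "{x. (\<phi> x)\<^sup>2 / u x \<noteq> 0} \<subseteq> K" using supp by auto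
  have "(\<Sum>x\<in>K. (\<phi> x)\<^sup>2 / u x * outflow b u x) = energy b u (\<lambda>x. (\<phi> x)\<^sup>2 / u x)"
    using energy_green[OF assms(2) supp'] by simp
  also have "\<dots> \<le> energy b \<phi> \<phi>"
    unfolding energy_finite_sum[OF assms(2) supp'] energy_finite_sum[OF assms(2) supp]
  proof (intro mult_left_mono sum_mono)
    fix x y
    show "b x y * (u x - u y) * ((\<phi> x)\<^sup>2 / u x - (\<phi> y)\<^sup>2 / u y) \<le> b x y * (\<phi> x - \<phi> y) * (\<phi> x - \<phi> y)"
      using mult_left_mono[OF picone_pointwise[OF u u, of x y "\<phi> x" "\<phi> y"] b_nonneg[of x y]]
      by (simp add: power2_eq_square mult.assoc)
  qed simp
  finally show ?thesis .
qed

section \<open>Spheres and radial functions\<close>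

lemma graph_dist_walk: "((\<lambda>u v. b u v > 0) ^^ graph_dist b x0 x) x0 x"
  unfolding graph_dist_def using rtranclp_imp_relpowp[OF connected_graph[of x0 x]] by (rule LeastI_ex)

lemma graph_dist_le: "((\<lambda>u v. b u v > 0) ^^ n) x0 x \<Longrightarrow> graph_dist b x0 x \<le> n"
  unfolding graph_dist_def by (rule Least_le)

lemma graph_dist_eq_0_iff: "graph_dist b x0 x = 0 \<longleftrightarrow> x = x0"
proof
  show "graph_dist b x0 x = 0" if "x = x0" using graph_dist_le[of 0 x0 x] that by simp
  show "x = x0" if "graph_dist b x0 x = 0" using graph_dist_walk[of x0 x] that by simp
qed

lemma graph_dist_neighbour: "b x y > 0 \<Longrightarrow> graph_dist b x0 y \<le> Suc (graph_dist b x0 x)"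
  using relpowp_Suc_I[OF graph_dist_walk] by (intro graph_dist_le)

lemma graph_dist_predecessor:
  assumes "graph_dist b x0 y = Suc n"
  shows "\<exists>x. graph_dist b x0 x = n \<and> b x y > 0"
proof -
  have "((\<lambda>u v. b u v > 0) ^^ Suc n) x0 y" using graph_dist_walk[of x0 y] assms by simp
  then obtain x where x: "((\<lambda>u v. b u v > 0) ^^ n) x0 x" "b x y > 0" by (rule relpowp_Suc_E)
  then have "graph_dist b x0 x = n"
    using graph_dist_le[OF x(1)] graph_dist_neighbour[OF x(2), of x0] assms by simp
  then show ?thesis using x(2) by blast
qed

lemma finite_sphere: "finite {x. graph_dist b x0 x = n}"
proof (induction n)
  case 0
  show ?case by (simp add: graph_dist_eq_0_iff)
next
  case (Suc n)
  have "{y. graph_dist b x0 y = Suc n} \<subseteq> (\<Union>x\<in>{x. graph_dist b x0 x = n}. {y. b x y > 0})"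
    using graph_dist_predecessor by fastforce
  then show ?case by (rule finite_subset) (simp add: Suc locally_finite)
qed

lemma finite_ball: "finite {x. graph_dist b x0 x \<le> n}"
proof -
  have "{x. graph_dist b x0 x \<le> n} = (\<Union>i\<le>n. {x. graph_dist b x0 x = i})" by auto
  then show ?thesis by (simp add: finite_sphere)
qed

text \<open>Above an empty sphere all spheres are empty, and the graph would be a finite ball.\<close>

lemma sphere_nonempty: "\<exists>x. graph_dist b x0 x = n"
proof (rule ccontr)
  assume none: "\<nexists>x. graph_dist b x0 x = n"
  have "\<nexists>x. graph_dist b x0 x = n + k" for k
  proof (induction k)
    case (Suc k) then show ?case using graph_dist_predecessor[of x0 _ "n + k"] by auto
  qed (use none in simp)
  then have "graph_dist b x0 x \<le> n" for x by (metis le_add_diff_inverse nat_le_linear)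
  then show False using finite_ball[of x0 n] infinite_vertices by simp
qed

lemma graph_sphere_eq:
  "graph_sphere b x0 (int n) = {x. graph_dist b x0 x = n}"
  "graph_sphere b x0 (int n + 1) = {x. graph_dist b x0 x = Suc n}"
  "graph_sphere b x0 (int n - 1) = {x. Suc (graph_dist b x0 x) = n}"
  by (auto simp: graph_sphere_def)

lemma kappa_plus_mass: "kappa_plus b m x0 x * m x = (\<Sum>y | graph_dist b x0 y = Suc (graph_dist b x0 x). b x y)"
  and kappa_minus_mass: "kappa_minus b m x0 x * m x = (\<Sum>y | Suc (graph_dist b x0 y) = graph_dist b x0 x. b x y)"
  using m_pos[of x] by (simp_all add: kappa_plus_def kappa_minus_def graph_sphere_eq)

lemma kappa_nonneg: "0 \<le> kappa_plus b m x0 x" "0 \<le> kappa_minus b m x0 x"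
  using m_pos[of x] by (auto simp: kappa_plus_def kappa_minus_def b_nonneg intro!: divide_nonneg_pos sum_nonneg)

text \<open>Neighbours of \<open>x\<close> lie in the sphere of \<open>x\<close>, where a radial function does not change, or in one of the two
  adjacent spheres. At the root the truncated subtraction is harmless, since \<open>kappa_minus\<close> vanishes there.\<close>

lemma outflow_radial:
  "outflow b (\<lambda>x. u (graph_dist b x0 x)) x =
    m x * (kappa_plus b m x0 x * (u (graph_dist b x0 x) - u (Suc (graph_dist b x0 x)))
         + kappa_minus b m x0 x * (u (graph_dist b x0 x) - u (graph_dist b x0 x - 1)))"
proof -
  let ?d = "graph_dist b x0"
  let ?r = "?d x"
  let ?P = "{y. ?d y = Suc ?r}" and ?M = "{y. Suc (?d y) = ?r}"
  let ?g = "\<lambda>y. b x y * (u ?r - u (?d y))"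
  have "?M \<subseteq> {y. ?d y \<le> ?r}" by auto
  then have fin: "finite ?P" "finite ?M" using finite_sphere finite_ball finite_subset by blast+
  have "sum ?g {y. b x y > 0} = sum ?g (?P \<union> ?M)"
  proof (rule sum.mono_neutral_cong[OF _ locally_finite])
    show "finite (?P \<union> ?M)" using fin by simp
    show "?g y = 0" if "y \<in> ?P \<union> ?M - {y. 0 < b x y}" for y
      using that b_nonneg[of x y] by (auto simp: not_less)
    show "?g y = 0" if y: "y \<in> {y. 0 < b x y} - (?P \<union> ?M)" for y
    proof -
      have "b x y > 0" "b y x > 0" using y b_sym[of x y] by auto
      then have "?d y \<le> Suc ?r" "?r \<le> Suc (?d y)" by (auto intro: graph_dist_neighbour)
      then have "?d y = ?r" using y by auto
      then show ?thesis by simp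
    qed
  qed simp
  also have "\<dots> = sum ?g ?P + sum ?g ?M" using fin by (intro sum.union_disjoint) auto
  also have "sum ?g ?P = (kappa_plus b m x0 x * m x) * (u ?r - u (Suc ?r))"
    unfolding kappa_plus_mass sum_distrib_right by (intro sum.cong) auto
  also have "sum ?g ?M = (kappa_minus b m x0 x * m x) * (u ?r - u (?r - 1))"
    unfolding kappa_minus_mass sum_distrib_right
  proof (intro sum.cong refl)
    fix y assume "y \<in> ?M"
    then have "?d y = ?r - 1" by auto
    then show "?g y = b x y * (u ?r - u (?r - 1))" by simp
  qed
  finally show ?thesis by (simp add: outflow_def algebra_simps)
qed

text \<open>A decreasing radial function falls in the outward direction and rises in the inward direction, so
  raising \<open>kappa_plus\<close> and lowering \<open>kappa_minus\<close> both increase its Laplacian. It stays a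
  supersolution on graphs with stronger curvature growth.\<close>

lemma radial_supersolution_bound:
  assumes stronger: "\<And>x. kp (graph_dist b x0 x) \<le> kappa_plus b m x0 x"
      "\<And>x. kappa_minus b m x0 x \<le> km (graph_dist b x0 x)"
    and u: "\<And>r. 0 < u r" and decreasing: "\<And>r. u (Suc r) \<le> u r"
    and super: "\<And>r. W r * u r \<le> kp r * (u r - u (Suc r)) + km r * (u r - u (r - 1))"
    and "finite K" and supp: "{x. \<phi> x \<noteq> 0} \<subseteq> K"
  shows "(\<Sum>x\<in>K. W (graph_dist b x0 x) * (\<phi> x)\<^sup>2 * m x) \<le> energy b \<phi> \<phi>"
proof -
  let ?d = "graph_dist b x0"
  have "(\<Sum>x\<in>K. W (?d x) * (\<phi> x)\<^sup>2 * m x) \<le> (\<Sum>x\<in>K. (\<phi> x)\<^sup>2 / u (?d x) * outflow b (\<lambda>x. u (?d x)) x)"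
  proof (rule sum_mono)
    fix x
    let ?r = "?d x"
    have "u ?r - u (?r - 1) \<le> 0" using decreasing[of "?r - 1"] by (cases ?r) auto
    then have "W ?r * u ?r \<le> kappa_plus b m x0 x * (u ?r - u (Suc ?r)) + kappa_minus b m x0 x * (u ?r - u (?r - 1))"
      using super[of ?r] mult_right_mono[OF stronger(1)[of x], of "u ?r - u (Suc ?r)"]
        mult_right_mono_neg[OF stronger(2)[of x], of "u ?r - u (?r - 1)"] decreasing[of ?r]
      by linarith
    then have "m x * (W ?r * u ?r) \<le> outflow b (\<lambda>x. u (?d x)) x"
      unfolding outflow_radial using m_pos[of x] by (intro mult_left_mono) auto
    then have "(\<phi> x)\<^sup>2 / u ?r * (m x * (W ?r * u ?r)) \<le> (\<phi> x)\<^sup>2 / u ?r * outflow b (\<lambda>x. u (?d x)) x"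
      using u[of ?r] by (intro mult_left_mono) auto
    then show "W ?r * (\<phi> x)\<^sup>2 * m x \<le> (\<phi> x)\<^sup>2 / u ?r * outflow b (\<lambda>x. u (?d x)) x"
      using u[of ?r] by (simp add: mult_ac)
  qed
  also have "\<dots> \<le> energy b \<phi> \<phi>" using u assms(6) supp by (intro picone_inequality)
  finally show ?thesis .
qed

end

section \<open>Radial eigenfunctions\<close>

text \<open>The eigenvalue equation \<open>kp r * (u r - u (r + 1)) + km r * (u r - u (r - 1)) = \<mu> * u r\<close>, solved for the value on the outer
  sphere and started with \<open>1\<close> at the root. The root has no inner sphere, whence the separate second
  equation.\<close>

fun radial_eigenfunction :: "(nat \<Rightarrow> real) \<Rightarrow> (nat \<Rightarrow> real) \<Rightarrow> real \<Rightarrow> nat \<Rightarrow> real" where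
  "radial_eigenfunction kp km \<mu> 0 = 1"
| "radial_eigenfunction kp km \<mu> (Suc 0) = 1 - \<mu> / kp 0"
| "radial_eigenfunction kp km \<mu> (Suc (Suc r)) = radial_eigenfunction kp km \<mu> (Suc r)
     - (\<mu> * radial_eigenfunction kp km \<mu> (Suc r)
        - km (Suc r) * (radial_eigenfunction kp km \<mu> (Suc r) - radial_eigenfunction kp km \<mu> r)) / kp (Suc r)"

lemma radial_eigenfunction_eq:
  fixes kp km :: "nat \<Rightarrow> real" and \<mu> :: real
  assumes "\<And>r. 0 < kp r"
  defines "u \<equiv> radial_eigenfunction kp km \<mu>"
  shows "kp r * (u r - u (Suc r)) + km r * (u r - u (r - 1)) = \<mu> * u r"
proof (cases r)
  case 0 then show ?thesis using assms(1)[of 0] by (simp add: u_def)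
next
  case (Suc n) then show ?thesis using assms(1)[of "Suc n"] by (simp add: u_def field_simps)
qed

text \<open>The equation writes the next drop of \<open>u\<close>, up to a positive factor, as \<open>\<mu> * u r\<close> plus a non-negative
  multiple of the previous drop.\<close>

lemma radial_eigenfunction_decreasing:
  fixes kp km :: "nat \<Rightarrow> real" and \<mu> :: real
  assumes kp: "\<And>r. 0 < kp r" and km: "\<And>r. 0 \<le> km r" and "0 \<le> \<mu>"
  defines "u \<equiv> radial_eigenfunction kp km \<mu>"
  assumes "\<And>i. i \<le> r \<Longrightarrow> 0 \<le> u i"
  shows "u (Suc r) \<le> u r"
  using assms(5)
proof (induction r)
  case 0
  have "0 \<le> kp 0 * (u 0 - u (Suc 0))"
    using radial_eigenfunction_eq[where kp = kp and km = km and \<mu> = \<mu> and r = 0, OF kp] 0 \<open>0 \<le> \<mu>\<close> by (simp add: u_def)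
  then show ?case using kp[of 0] by (simp add: zero_le_mult_iff)
next
  case (Suc r)
  then have "u (Suc r) \<le> u r" by simp
  then have "km (Suc r) * (u (Suc r) - u r) \<le> 0" using km by (simp add: mult_nonneg_nonpos)
  moreover have "0 \<le> \<mu> * u (Suc r)" using Suc.prems \<open>0 \<le> \<mu>\<close> by simp
  ultimately have "0 \<le> kp (Suc r) * (u (Suc r) - u (Suc (Suc r)))"
    using radial_eigenfunction_eq[where kp = kp and km = km and \<mu> = \<mu> and r = "Suc r", OF kp] unfolding u_def by simp
  then show ?case using kp[of "Suc r"] by (simp add: zero_le_mult_iff)
qed

context weighted_graph
begin

text \<open>Otherwise cut \<open>u\<close> off before the first radius where it is not positive. Inside the support, weaker
  curvature growth makes the decreasing function \<open>u\<close> a subsolution. On the last sphere, replacing the non-positive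
  next value by \<open>0\<close> only lowers the Laplacian. Hence the Rayleigh quotient of the cut-off function is at most
  \<open>\<mu>\<close>, below the bound \<open>\<nu>\<close>.\<close>

lemma radial_eigenfunction_pos:
  assumes weaker: "\<And>x. kappa_plus b m x0 x \<le> kp (graph_dist b x0 x)"
      "\<And>x. km (graph_dist b x0 x) \<le> kappa_minus b m x0 x"
    and kp: "\<And>r. 0 < kp r" and km: "\<And>r. 0 \<le> km r"
    and "0 \<le> \<mu>" "\<mu> < \<nu>" and bound: "rayleigh_bound b m \<nu>"
  shows "0 < radial_eigenfunction kp km \<mu> r"
proof (rule ccontr)
  define u where "u = radial_eigenfunction kp km \<mu>"
  let ?d = "graph_dist b x0"
  assume "\<not> 0 < radial_eigenfunction kp km \<mu> r"
  then have ex: "\<exists>r. u r \<le> 0" by (auto simp: u_def not_less)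
  define R where "R = (LEAST r. u r \<le> 0)"
  have R: "u R \<le> 0" unfolding R_def using ex by (rule LeastI_ex)
  have before: "0 < u i" if "i < R" for i using not_less_Least[of i "\<lambda>r. u r \<le> 0"] that by (simp add: R_def)
  have "R \<noteq> 0" using R by (intro notI) (simp add: u_def)
  then obtain n where n: "R = Suc n" by (cases R) auto
  have decreasing: "u (Suc i) \<le> u i" if "i \<le> n" for i
    unfolding u_def by (rule radial_eigenfunction_decreasing[where kp = kp and km = km, OF kp km \<open>0 \<le> \<mu>\<close>])
      (use before n that in \<open>fastforce simp: u_def intro: less_imp_le\<close>)
  \<comment> \<open>\<open>n + 1\<close> is the first radius at which \<open>u\<close> is not positive.\<close>
  let ?t = "\<lambda>i. if i \<le> n then u i else 0" and ?K = "{x. ?d x \<le> n}"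
  let ?\<phi> = "\<lambda>x. ?t (?d x)"
  have supp: "{x. ?\<phi> x \<noteq> 0} \<subseteq> ?K" by auto
  have fs: "?\<phi> \<in> finitely_supported"
    unfolding finitely_supported_def by (rule CollectI, rule finite_subset[OF _ finite_ball[of x0 n]]) auto
  have "energy b ?\<phi> ?\<phi> = (\<Sum>x\<in>?K. ?\<phi> x * outflow b ?\<phi> x)"
    by (rule energy_green[OF finite_ball supp])
  also have "\<dots> \<le> (\<Sum>x\<in>?K. ?\<phi> x * (\<mu> * ?\<phi> x * m x))"
  proof (intro sum_mono mult_left_mono)
    fix x assume x: "x \<in> ?K"
    let ?i = "?d x"
    have drop: "0 \<le> u ?i - u (Suc ?i)" using decreasing[of ?i] x by simp
    have rise: "u ?i - u (?i - 1) \<le> 0" using decreasing[of "?i - 1"] x by (cases ?i) auto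
    have t: "?t ?i = u ?i" "?t (?i - 1) = u (?i - 1)" using x by auto
    have "?t ?i - ?t (Suc ?i) \<le> u ?i - u (Suc ?i)" using x R n by (cases "?i = n") auto
    then have "kappa_plus b m x0 x * (?t ?i - ?t (Suc ?i)) \<le> kappa_plus b m x0 x * (u ?i - u (Suc ?i))"
      by (rule mult_left_mono) (rule kappa_nonneg)
    also have "\<dots> \<le> kp ?i * (u ?i - u (Suc ?i))" using weaker(1) drop by (rule mult_right_mono)
    finally have "kappa_plus b m x0 x * (?t ?i - ?t (Suc ?i)) + kappa_minus b m x0 x * (?t ?i - ?t (?i - 1)) \<le> \<mu> * u ?i"
      using mult_right_mono_neg[OF weaker(2)[of x] rise]
        radial_eigenfunction_eq[where kp = kp and km = km and \<mu> = \<mu> and r = ?i, OF kp, folded u_def]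
      unfolding t by linarith
    from mult_left_mono[OF this less_imp_le[OF m_pos[of x]]]
    show "outflow b ?\<phi> x \<le> \<mu> * ?\<phi> x * m x"
      unfolding outflow_radial[of ?t] using x by (simp add: mult_ac)
    show "0 \<le> ?\<phi> x" using before[of ?i] x n by simp
  qed
  also have "\<dots> = \<mu> * l2_inner m ?\<phi> ?\<phi>"
    unfolding l2_inner_finite_sum[OF finite_ball supp] sum_distrib_left by (intro sum.cong) auto
  finally have "energy b ?\<phi> ?\<phi> \<le> \<mu> * l2_inner m ?\<phi> ?\<phi>" .
  moreover have "\<nu> * l2_inner m ?\<phi> ?\<phi> \<le> energy b ?\<phi> ?\<phi>" using bound fs unfolding rayleigh_bound_def by blast
  moreover have "0 < l2_inner m ?\<phi> ?\<phi>"
  proof -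
    have "m x0 * (?\<phi> x0)\<^sup>2 \<le> l2_inner m ?\<phi> ?\<phi>" by (rule vertex.point_mass_le) (rule finitely_supported_l2[OF fs])
    moreover have "?\<phi> x0 = 1" using graph_dist_eq_0_iff[of x0 x0] by (simp add: u_def)
    ultimately show ?thesis using m_pos[of x0] by simp
  qed
  ultimately have "\<nu> * l2_inner m ?\<phi> ?\<phi> \<le> \<mu> * l2_inner m ?\<phi> ?\<phi>" by linarith
  then show False using \<open>\<mu> < \<nu>\<close> \<open>0 < l2_inner m ?\<phi> ?\<phi>\<close> by (simp add: mult_le_cancel_right)
qed

text \<open>Barta's principle: a positive supersolution at level \<open>\<mu>\<close> bounds the form below by \<open>\<mu>\<close>.\<close>

lemma rayleigh_bound_of_radial_eigenfunction:
  assumes stronger: "\<And>x. kp (graph_dist b x0 x) \<le> kappa_plus b m x0 x"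
      "\<And>x. kappa_minus b m x0 x \<le> km (graph_dist b x0 x)"
    and kp: "\<And>r. 0 < kp r" and km: "\<And>r. 0 \<le> km r" and "0 \<le> \<mu>"
    and pos: "\<And>r. 0 < radial_eigenfunction kp km \<mu> r"
  shows "rayleigh_bound b m \<mu>"
  unfolding rayleigh_bound_def
proof
  fix \<phi> :: "'v \<Rightarrow> real" assume "\<phi> \<in> finitely_supported"
  then have fin: "finite {x. \<phi> x \<noteq> 0}" by (simp add: finitely_supported_def)
  let ?u = "radial_eigenfunction kp km \<mu>"
  have "(\<Sum>x | \<phi> x \<noteq> 0. \<mu> * (\<phi> x)\<^sup>2 * m x) \<le> energy b \<phi> \<phi>"
  proof (rule radial_supersolution_bound[where u = ?u and W = "\<lambda>_. \<mu>" and kp = kp and km = km,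
        OF stronger pos _ _ fin subset_refl])
    show "?u (Suc r) \<le> ?u r" for r
      using pos by (intro radial_eigenfunction_decreasing kp km \<open>0 \<le> \<mu>\<close>) (simp add: less_imp_le)
    show "\<mu> * ?u r \<le> kp r * (?u r - ?u (Suc r)) + km r * (?u r - ?u (r - 1))" for r
      using radial_eigenfunction_eq[where kp = kp and km = km and \<mu> = \<mu> and r = r, OF kp] by linarith
  qed
  then show "\<mu> * l2_inner m \<phi> \<phi> \<le> energy b \<phi> \<phi>"
    unfolding l2_inner_finite_sum[OF fin subset_refl] sum_distrib_left by (simp add: power2_eq_square mult.assoc)
qed

end

section \<open>Finite linear algebra\<close>

text \<open>Gaussian elimination: a pivot \<open>f j x \<noteq> 0\<close> removes one point and one function.\<close>

lemma finite_dependence: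
  fixes f :: "'i \<Rightarrow> 'x \<Rightarrow> real"
  assumes "finite F" "finite I" "card F < card I"
  shows "\<exists>c. (\<exists>i\<in>I. c i \<noteq> 0) \<and> (\<forall>x\<in>F. (\<Sum>i\<in>I. c i * f i x) = 0)"
  using assms
proof (induction F arbitrary: I f rule: finite_induct)
  case empty
  then obtain i where "i \<in> I" by fastforce
  then show ?case by (intro exI[of _ "\<lambda>_. 1"]) auto
next
  case (insert x F)
  show ?case
  proof (cases "\<forall>i\<in>I. f i x = 0")
    case True
    have "card F < card I" using insert by simp
    then obtain c where "\<exists>i\<in>I. c i \<noteq> 0" "\<forall>y\<in>F. (\<Sum>i\<in>I. c i * f i y) = 0"
      using insert.IH[OF \<open>finite I\<close>] by blast
    then show ?thesis using True by (intro exI[of _ c]) auto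
  next
    case False
    then obtain j where j: "j \<in> I" "f j x \<noteq> 0" by blast
    let ?J = "I - {j}" and ?g = "\<lambda>i y. f i y - f i x / f j x * f j y"
    have "finite ?J" "card F < card ?J" using insert j by auto
    then obtain c where c: "\<exists>i\<in>?J. c i \<noteq> 0" "\<forall>y\<in>F. (\<Sum>i\<in>?J. c i * ?g i y) = 0"
      using insert.IH[of ?J ?g] by blast
    let ?c = "\<lambda>i. if i = j then - (\<Sum>k\<in>?J. c k * f k x / f j x) else c i"
    have eq: "(\<Sum>i\<in>I. ?c i * f i y) = (\<Sum>i\<in>?J. c i * ?g i y)" for y
    proof -
      have "(\<Sum>i\<in>I. ?c i * f i y) = ?c j * f j y + (\<Sum>i\<in>?J. ?c i * f i y)"
        using \<open>finite I\<close> j(1) by (rule sum.remove)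
      also have "(\<Sum>i\<in>?J. ?c i * f i y) = (\<Sum>i\<in>?J. c i * f i y)" by (intro sum.cong) auto
      finally show ?thesis
        by (simp add: right_diff_distrib sum_subtractf sum_distrib_right mult.assoc)
    qed
    have "\<forall>y\<in>insert x F. (\<Sum>i\<in>I. ?c i * f i y) = 0"
      unfolding eq using c(2) j(2) by auto
    moreover have "\<exists>i\<in>I. ?c i \<noteq> 0" using c(1) by auto
    ultimately show ?thesis by (intro exI[of _ ?c] conjI)
  qed
qed

text \<open>The rows of \<open>a\<close> and a point mass are \<open>card B + 1\<close> functions on \<open>B\<close>, hence dependent. By injectivity the point
  mass, indexed by \<open>None\<close>, has a non-zero coefficient, so it is a combination of rows; the coefficients
  form the inverse matrix \<open>e\<close>.\<close>

lemma finite_linear_inverse: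
  fixes a :: "'x \<Rightarrow> 'x \<Rightarrow> real"
  assumes "finite B"
    and inj: "\<And>c. (\<forall>x\<in>B. (\<Sum>y\<in>B. c y * a y x) = 0) \<Longrightarrow> \<forall>y\<in>B. c y = 0"
  shows "\<exists>e. \<forall>d. \<forall>x\<in>B. (\<Sum>y\<in>B. (\<Sum>z\<in>B. d z * e z y) * a y x) = d x"
proof -
  have "\<exists>c. \<forall>x\<in>B. (\<Sum>y\<in>B. c y * a y x) = (if x = z then 1 else 0)" for z
  proof -
    let ?f = "\<lambda>i x. case i of None \<Rightarrow> (if x = z then 1 else 0) | Some y \<Rightarrow> a y x"
    have "card B < card (insert None (Some ` B))"
      using assms(1) by (simp add: card_image)
    then obtain c where c: "\<exists>i\<in>insert None (Some ` B). c i \<noteq> 0"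
      "\<forall>x\<in>B. (\<Sum>i\<in>insert None (Some ` B). c i * ?f i x) = 0"
      using finite_dependence[OF assms(1), of "insert None (Some ` B)" ?f] assms(1) by auto
    have dep: "c None * (if x = z then 1 else 0) + (\<Sum>y\<in>B. c (Some y) * a y x) = 0" if "x \<in> B" for x
      using c(2) that assms(1) by (simp add: sum.reindex)
    have "c None \<noteq> 0"
    proof
      assume 0: "c None = 0"
      then have "\<forall>x\<in>B. (\<Sum>y\<in>B. c (Some y) * a y x) = 0" using dep by simp
      then have "\<forall>y\<in>B. c (Some y) = 0" by (rule inj)
      then show False using c(1) 0 by auto
    qed
    have "(\<Sum>y\<in>B. - c (Some y) / c None * a y x) = (if x = z then 1 else 0)" if "x \<in> B" for x
    proof -
      have "(\<Sum>y\<in>B. - c (Some y) / c None * a y x) = - (\<Sum>y\<in>B. c (Some y) * a y x) / c None"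
        by (simp add: sum_divide_distrib sum_negf)
      also have "\<dots> = (if x = z then 1 else 0)"
        using dep[OF that] \<open>c None \<noteq> 0\<close> by (simp add: field_simps split: if_splits)
      finally show ?thesis .
    qed
    then show ?thesis by (intro exI[of _ "\<lambda>y. - c (Some y) / c None"] ballI)
  qed
  then have "\<exists>e. \<forall>z. \<forall>x\<in>B. (\<Sum>y\<in>B. e z y * a y x) = (if x = z then 1 else 0)"
    by (intro choice allI)
  then obtain e where e: "\<And>z x. x \<in> B \<Longrightarrow> (\<Sum>y\<in>B. e z y * a y x) = (if x = z then 1 else 0)"
    by auto
  have "(\<Sum>y\<in>B. (\<Sum>z\<in>B. d z * e z y) * a y x) = d x" if "x \<in> B" for d x
  proof -
    have "(\<Sum>y\<in>B. (\<Sum>z\<in>B. d z * e z y) * a y x) = (\<Sum>z\<in>B. d z * (\<Sum>y\<in>B. e z y * a y x))"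
      by (subst sum_distrib_right, subst sum.swap) (simp add: sum_distrib_left mult.assoc)
    also have "\<dots> = d x" using e[OF that] that assms(1) by (simp add: if_distrib[of "(*) _"] sum.delta' cong: if_cong)
    finally show ?thesis .
  qed
  then show ?thesis by (intro exI[of _ e] allI ballI)
qed

text \<open>Evaluation at one point of \<open>B\<close> is a functional on \<open>E\<close>, and its kernel is determined by the remaining
  points. One function outside the kernel completes a spanning set.\<close>

lemma finite_dimensional_of_finite_restriction:
  fixes E :: "('x \<Rightarrow> real) set"
  assumes "finite B" and comb: "\<And>f g t. f \<in> E \<Longrightarrow> g \<in> E \<Longrightarrow> (\<lambda>x. f x + t * g x) \<in> E"
    and "\<And>f. f \<in> E \<Longrightarrow> \<forall>x\<in>B. f x = 0 \<Longrightarrow> f = (\<lambda>x. 0)"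
  shows "finite_dimensional E"
  using assms
proof (induction B arbitrary: E rule: finite_induct)
  case empty
  then show ?case unfolding finite_dimensional_def by (intro exI[of _ "{}"]) auto
next
  case (insert z B)
  let ?E = "{f \<in> E. f z = 0}"
  have "finite_dimensional ?E" using insert.prems by (intro insert.IH) auto
  then obtain F where F: "F \<subseteq> ?E" "finite F" "\<And>f. f \<in> ?E \<Longrightarrow> \<exists>c. f = (\<lambda>x. \<Sum>g\<in>F. c g * g x)"
    unfolding finite_dimensional_def by blast
  show ?case
  proof (cases "E = ?E")
    case True
    then have "finite_dimensional E \<longleftrightarrow> finite_dimensional ?E" by simp
    then show ?thesis using \<open>finite_dimensional ?E\<close> by blast
  next
    case False
    then obtain h where h: "h \<in> E" "h z \<noteq> 0" by blast
    then have "h \<notin> F" using F(1) by auto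
    have "\<exists>c. f = (\<lambda>x. \<Sum>g\<in>insert h F. c g * g x)" if f: "f \<in> E" for f
    proof -
      let ?t = "f z / h z"
      have "(\<lambda>x. f x + - ?t * h x) \<in> ?E" using insert.prems(1)[OF f h(1), of "- ?t"] h(2) by simp
      then obtain c where c: "(\<lambda>x. f x + - ?t * h x) = (\<lambda>x. \<Sum>g\<in>F. c g * g x)" using F(3) by blast
      have "(\<Sum>g\<in>insert h F. (c(h := ?t)) g * g x) = f x" for x
      proof -
        have "(\<Sum>g\<in>F. (c(h := ?t)) g * g x) = (\<Sum>g\<in>F. c g * g x)"
          using \<open>h \<notin> F\<close> by (intro sum.cong) auto
        then show ?thesis using fun_cong[OF c, of x] F(2) \<open>h \<notin> F\<close> by simp
      qed
      then show ?thesis by (intro exI[of _ "c(h := ?t)"]) (simp add: fun_eq_iff)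
    qed
    moreover have "insert h F \<subseteq> E" using h F(1) by auto
    ultimately show ?thesis unfolding finite_dimensional_def using F(2) by (intro exI[of _ "insert h F"]) auto
  qed
qed

section \<open>Discrete spectrum\<close>

context nonneg_weight
begin

lemma l2_sum: "finite I \<Longrightarrow> (\<And>i. i \<in> I \<Longrightarrow> f i \<in> l2 w) \<Longrightarrow> (\<lambda>x. \<Sum>i\<in>I. c i * f i x) \<in> l2 w"
  by (induction I rule: finite_induct) (auto intro!: l2_add l2_scale)

lemma l2_inner_sum_left:
  assumes "finite I" "\<And>i. i \<in> I \<Longrightarrow> f i \<in> l2 w" "h \<in> l2 w"
  shows "l2_inner w (\<lambda>x. \<Sum>i\<in>I. c i * f i x) h = (\<Sum>i\<in>I. c i * l2_inner w (f i) h)"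
  using assms
proof (induction I rule: finite_induct)
  case empty show ?case by (simp add: l2_inner_def)
next
  case (insert j I)
  then have "l2_inner w (\<lambda>x. c j * f j x + (\<Sum>i\<in>I. c i * f i x)) h
      = c j * l2_inner w (f j) h + l2_inner w (\<lambda>x. \<Sum>i\<in>I. c i * f i x) h"
    by (subst l2_inner_add_left) (auto intro: l2_scale l2_sum simp: l2_inner_scale_left)
  then show ?case using insert by simp
qed

end

text \<open>A lower bound for the form that holds off a finite set, at any height \<open>K\<close>. The expression on the right is the
  form of \<open>L + K 1\<^sub>B\<close>; stated on all finitely supported functions rather than on those vanishing on \<open>B\<close>, the
  bound says that \<open>L + K 1\<^sub>B - \<mu>\<close> is coercive for \<open>\<mu> < K\<close>.\<close>

definition confining :: "('v \<Rightarrow> 'v \<Rightarrow> real) \<Rightarrow> ('v \<Rightarrow> real) \<Rightarrow> bool" where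
  "confining b m \<longleftrightarrow> (\<forall>K\<ge>0. \<exists>B. finite B \<and> (\<forall>\<phi>\<in>finitely_supported.
      K * l2_inner m \<phi> \<phi> \<le> energy b \<phi> \<phi> + K * (\<Sum>x\<in>B. (\<phi> x)\<^sup>2 * m x)))"

context weighted_graph
begin

definition well :: "real \<Rightarrow> 'v set \<Rightarrow> 'v \<Rightarrow> real" where
  "well K B x = (if x \<in> B then K else 0)"

lemma bounded_well: "bounded (range (\<lambda>x. well K B x - \<mu>))"
proof -
  have "range (\<lambda>x. well K B x - \<mu>) \<subseteq> {K - \<mu>, 0 - \<mu>}" by (auto simp: well_def)
  then show ?thesis by (rule bounded_subset[rotated]) (intro finite_imp_bounded, simp)
qed

lemma well_inner: "finite B \<Longrightarrow> l2_inner m (\<lambda>x. well K B x * f x) f = K * (\<Sum>x\<in>B. (f x)\<^sup>2 * m x)"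
  unfolding l2_inner_def
  by (subst infsum_eq_finite_sum[of B]) (auto simp: well_def sum_distrib_left power2_eq_square mult_ac)

lemma well_schroedinger:
  assumes "finite B" "f \<in> form_domain b m"
  shows "schroedinger (\<lambda>x. well K B x - \<mu>) f f =
    energy b f f + K * (\<Sum>x\<in>B. (f x)\<^sup>2 * m x) - \<mu> * l2_inner m f f"
proof -
  have f: "f \<in> l2 m" using assms(2) by (rule form_domain_l2)
  have "(\<lambda>x. well K B x * f x) \<in> l2 m"
    using bounded_well[of K B 0] by (intro potential_l2 f) simp
  then have "l2_inner m (\<lambda>x. (well K B x - \<mu>) * f x) f =
      l2_inner m (\<lambda>x. well K B x * f x) f - l2_inner m (\<lambda>x. \<mu> * f x) f"
    unfolding left_diff_distrib using f by (intro vertex.l2_inner_diff_left vertex.l2_scale)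
  then show ?thesis
    by (simp add: schroedinger_def well_inner[OF assms(1)] vertex.l2_inner_scale_left)
qed

lemma confining_extend:
  assumes B: "finite B" and bound: "\<forall>\<phi>\<in>finitely_supported.
      K * l2_inner m \<phi> \<phi> \<le> energy b \<phi> \<phi> + K * (\<Sum>x\<in>B. (\<phi> x)\<^sup>2 * m x)"
    and f: "f \<in> form_domain b m"
  shows "K * l2_inner m f f \<le> energy b f f + K * (\<Sum>x\<in>B. (f x)\<^sup>2 * m x)"
proof -
  have "K * l2_inner m f f \<le> schroedinger (\<lambda>x. well K B x - 0) f f"
  proof (rule coercive_extend[OF bounded_well _ f])
    fix \<phi> :: "'v \<Rightarrow> real" assume fs: "\<phi> \<in> finitely_supported"
    then show "K * l2_inner m \<phi> \<phi> \<le> schroedinger (\<lambda>x. well K B x - 0) \<phi> \<phi>"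
      unfolding well_schroedinger[OF B finitely_supported_form_domain[OF fs]] using bound by simp
  qed
  then show ?thesis unfolding well_schroedinger[OF B f] by simp
qed

lemma zero_laplacian_domain: "(\<lambda>x. 0) \<in> laplacian_domain b m" "laplacian b m (\<lambda>x. 0) = (\<lambda>x. 0)"
proof -
  have "energy b (\<lambda>x. 0) g = l2_inner m (\<lambda>x. 0) g" for g
    by (simp add: energy_def l2_inner_def case_prod_unfold)
  then show "(\<lambda>x. 0) \<in> laplacian_domain b m" "laplacian b m (\<lambda>x. 0) = (\<lambda>x. 0)"
    using laplacian_eqI[of "\<lambda>x. 0" "\<lambda>x. 0"] finitely_supported_form_domain by auto
qed

lemma laplacian_sum:
  assumes "finite I" "\<And>i. i \<in> I \<Longrightarrow> f i \<in> laplacian_domain b m"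
  shows "(\<lambda>x. \<Sum>i\<in>I. c i * f i x) \<in> laplacian_domain b m \<and>
    laplacian b m (\<lambda>x. \<Sum>i\<in>I. c i * f i x) = (\<lambda>x. \<Sum>i\<in>I. c i * laplacian b m (f i) x)"
  using assms
proof (induction I rule: finite_induct)
  case empty show ?case by (simp add: zero_laplacian_domain)
next
  case (insert j I)
  let ?s = "\<lambda>x. \<Sum>i\<in>I. c i * f i x"
  have s: "?s \<in> laplacian_domain b m"
    "laplacian b m ?s = (\<lambda>x. \<Sum>i\<in>I. c i * laplacian b m (f i) x)"
    using insert by auto
  have fj: "f j \<in> laplacian_domain b m" using insert by simp
  have eq: "(\<lambda>x. \<Sum>i\<in>insert j I. c i * f i x) = (\<lambda>x. ?s x + c j * f j x)"
    using insert(1,2) by (auto simp: add.commute)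
  show ?case unfolding eq using laplacian_combination[OF s(1) fj, of "c j"] s(2) insert(1,2)
    by (auto simp: add.commute)
qed

lemma eigenfunctions_orthogonal:
  assumes "f \<in> laplacian_domain b m" "laplacian b m f = (\<lambda>x. \<mu> * f x)"
    and "g \<in> laplacian_domain b m" "laplacian b m g = (\<lambda>x. \<nu> * g x)" and "\<mu> \<noteq> \<nu>"
  shows "l2_inner m f g = 0"
proof -
  have "\<mu> * l2_inner m f g = energy b f g"
    using laplacian_weak(2)[OF assms(1) laplacian_domain_form_domain[OF assms(3)]] assms(2)
    by (simp add: vertex.l2_inner_scale_left)
  also have "\<dots> = energy b g f" by (simp add: energy_eq_l2_inner edge.l2_inner_commute)
  also have "\<dots> = \<nu> * l2_inner m g f"
    using laplacian_weak(2)[OF assms(3) laplacian_domain_form_domain[OF assms(1)]] assms(4)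
    by (simp add: vertex.l2_inner_scale_left)
  finally show ?thesis using assms(5) vertex.l2_inner_commute[of g f] by simp
qed

definition eigenvalue :: "real \<Rightarrow> bool" where
  "eigenvalue \<mu> \<longleftrightarrow> (\<exists>f\<in>op_eigenspace (laplacian_domain b m) (laplacian b m) \<mu>. f \<noteq> (\<lambda>x. 0))"

text \<open>If there were more eigenvalues than points in \<open>B\<close>, some non-trivial combination \<open>f\<close> of their eigenfunctions
  would vanish on \<open>B\<close>. Confinement then gives \<open>Q(f, f) \<ge> K \<langle>f, f\<rangle>\<close>, while orthogonality of the eigenfunctions gives
  \<open>Q(f, f) < K \<langle>f, f\<rangle>\<close>.\<close>

lemma confining_card_eigenvalues:
  assumes B: "finite B" and bound: "\<forall>\<phi>\<in>finitely_supported.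
      K * l2_inner m \<phi> \<phi> \<le> energy b \<phi> \<phi> + K * (\<Sum>x\<in>B. (\<phi> x)\<^sup>2 * m x)"
    and M: "finite M" "\<And>\<mu>. \<mu> \<in> M \<Longrightarrow> eigenvalue \<mu> \<and> \<mu> < K"
  shows "card M \<le> card B"
proof (rule ccontr)
  assume "\<not> card M \<le> card B"
  then have card: "card B < card M" by simp
  have "\<forall>\<mu>\<in>M. \<exists>g. g \<in> laplacian_domain b m \<and> laplacian b m g = (\<lambda>x. \<mu> * g x) \<and> g \<noteq> (\<lambda>x. 0)"
    using M(2) unfolding eigenvalue_def op_eigenspace_def by blast
  then obtain g where g: "\<And>\<mu>. \<mu> \<in> M \<Longrightarrow> g \<mu> \<in> laplacian_domain b m"
    "\<And>\<mu>. \<mu> \<in> M \<Longrightarrow> laplacian b m (g \<mu>) = (\<lambda>x. \<mu> * g \<mu> x)"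
    "\<And>\<mu>. \<mu> \<in> M \<Longrightarrow> g \<mu> \<noteq> (\<lambda>x. 0)" by metis
  have gl2: "g \<mu> \<in> l2 m" if "\<mu> \<in> M" for \<mu>
    using g(1)[OF that] by (intro form_domain_l2 laplacian_domain_form_domain)
  have inner_sum: "l2_inner m (\<lambda>x. \<Sum>\<mu>\<in>M. d \<mu> * g \<mu> x) h = (\<Sum>\<mu>\<in>M. d \<mu> * l2_inner m (g \<mu>) h)"
    if "h \<in> l2 m" for d h
    using M(1) gl2 that by (rule vertex.l2_inner_sum_left)
  obtain c where c: "\<exists>\<mu>\<in>M. c \<mu> \<noteq> 0" "\<forall>x\<in>B. (\<Sum>\<mu>\<in>M. c \<mu> * g \<mu> x) = 0"
    using finite_dependence[OF B M(1) card, of g] by blast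
  define f where "f = (\<lambda>x. \<Sum>\<mu>\<in>M. c \<mu> * g \<mu> x)"
  have dom: "f \<in> laplacian_domain b m" and lap: "laplacian b m f = (\<lambda>x. \<Sum>\<mu>\<in>M. c \<mu> * laplacian b m (g \<mu>) x)"
    using laplacian_sum[of M g c, OF M(1) g(1)] by (auto simp: f_def)
  have fD: "f \<in> form_domain b m" using dom by (rule laplacian_domain_form_domain)
  let ?q = "\<lambda>\<mu>. (c \<mu>)\<^sup>2 * l2_inner m (g \<mu>) (g \<mu>)"
  have diag: "l2_inner m (g \<mu>) f = c \<mu> * l2_inner m (g \<mu>) (g \<mu>)" if "\<mu> \<in> M" for \<mu>
  proof -
    have "l2_inner m (g \<mu>) f = l2_inner m f (g \<mu>)" by (rule vertex.l2_inner_commute)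
    also have "\<dots> = (\<Sum>\<nu>\<in>M. c \<nu> * l2_inner m (g \<nu>) (g \<mu>))"
      unfolding f_def by (rule inner_sum[OF gl2[OF that]])
    also have "\<dots> = (\<Sum>\<nu>\<in>{\<mu>}. c \<nu> * l2_inner m (g \<nu>) (g \<mu>))"
    proof (rule sum.mono_neutral_right)
      show "\<forall>\<nu>\<in>M - {\<mu>}. c \<nu> * l2_inner m (g \<nu>) (g \<mu>) = 0"
        using eigenfunctions_orthogonal[OF g(1,2) g(1)[OF that] g(2)[OF that]] by auto
    qed (use M(1) that in auto)
    finally show ?thesis by simp
  qed
  have "l2_inner m f f = (\<Sum>\<mu>\<in>M. c \<mu> * l2_inner m (g \<mu>) f)"
    using inner_sum[OF form_domain_l2[OF fD], of c] unfolding f_def .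
  then have norm: "l2_inner m f f = (\<Sum>\<mu>\<in>M. ?q \<mu>)"
    using diag by (simp add: power2_eq_square mult.assoc)
  have "energy b f f = l2_inner m (\<lambda>x. \<Sum>\<mu>\<in>M. c \<mu> * \<mu> * g \<mu> x) f"
    using laplacian_weak(2)[OF dom fD] unfolding lap by (simp add: g(2) mult.assoc)
  also have "\<dots> = (\<Sum>\<mu>\<in>M. c \<mu> * \<mu> * l2_inner m (g \<mu>) f)"
    by (rule inner_sum[OF form_domain_l2[OF fD]])
  finally have energy: "energy b f f = (\<Sum>\<mu>\<in>M. \<mu> * ?q \<mu>)"
    using diag by (simp add: power2_eq_square mult_ac)
  have "(\<Sum>x\<in>B. (f x)\<^sup>2 * m x) = 0" using c(2) by (simp add: f_def)
  then have "(\<Sum>\<mu>\<in>M. (K - \<mu>) * ?q \<mu>) \<le> 0"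
    using confining_extend[OF B bound fD] unfolding norm energy
    by (simp add: left_diff_distrib sum_subtractf sum_distrib_left)
  moreover have nonneg: "0 \<le> (K - \<mu>) * ?q \<mu>" if "\<mu> \<in> M" for \<mu>
    using M(2)[OF that] vertex.l2_inner_self_nonneg[of "g \<mu>"] by simp
  ultimately have zero: "(K - \<mu>) * ?q \<mu> = 0" if "\<mu> \<in> M" for \<mu>
    using sum_nonneg_eq_0_iff[OF M(1), of "\<lambda>\<mu>. (K - \<mu>) * ?q \<mu>"] sum_nonneg[of M "\<lambda>\<mu>. (K - \<mu>) * ?q \<mu>"] that
    by (metis (no_types, lifting) order_antisym)
  obtain \<mu> where \<mu>: "\<mu> \<in> M" "c \<mu> \<noteq> 0" using c(1) by blast
  then have "l2_inner m (g \<mu>) (g \<mu>) = 0" using zero[OF \<mu>(1)] M(2)[OF \<mu>(1)] by simp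
  then show False using l2_inner_self_eq_0[OF gl2[OF \<mu>(1)]] g(3)[OF \<mu>(1)] by simp
qed

text \<open>The Fredholm alternative. The operator \<open>T = L + K 1\<^sub>B - \<mu>\<close> is coercive and has a bounded inverse \<open>G\<close>. The
  equation \<open>(L - \<mu>) f = h\<close> is equivalent to \<open>T f = h + K 1\<^sub>B f\<close>, that is, to
  \<open>f = G h + K (\<Sum>y\<in>B. f y * G \<delta>\<^sub>y)\<close>. Restricted to \<open>B\<close>, this is a linear system for the values of \<open>f\<close> on \<open>B\<close>, with
  matrix \<open>a\<close>. A solution of the homogeneous system extends to an eigenfunction, so \<open>a\<close> is invertible unless
  \<open>\<mu>\<close> is an eigenvalue.\<close>

lemma confining_resolvent:
  assumes B: "finite B" and bound: "\<forall>\<phi>\<in>finitely_supported.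
      K * l2_inner m \<phi> \<phi> \<le> energy b \<phi> \<phi> + K * (\<Sum>x\<in>B. (\<phi> x)\<^sup>2 * m x)"
    and "\<mu> < K" and not_eigenvalue: "\<not> eigenvalue \<mu>"
  shows "\<mu> \<in> resolvent_set m (laplacian_domain b m) (laplacian b m)"
proof -
  let ?p = "\<lambda>x. well K B x - \<mu>"
  let ?T = "\<lambda>f x. laplacian b m f x + ?p x * f x"
  let ?\<delta> = "\<lambda>y x::'v. if x = y then 1 else 0 :: real"
  have pos: "0 < K - \<mu>" using assms(3) by simp
  have coercive: "(K - \<mu>) * l2_inner m \<phi> \<phi> \<le> schroedinger ?p \<phi> \<phi>" if "\<phi> \<in> finitely_supported" for \<phi>
    using bound that unfolding well_schroedinger[OF B finitely_supported_form_domain[OF that]]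
    by (simp add: left_diff_distrib)
  have "\<forall>h\<in>l2 m. \<exists>f\<in>laplacian_domain b m. ?T f = h"
    using coercive_operator_onto[OF bounded_well pos coercive] by blast
  then obtain G where G: "\<And>h. h \<in> l2 m \<Longrightarrow> G h \<in> laplacian_domain b m" "\<And>h. h \<in> l2 m \<Longrightarrow> ?T (G h) = h"
    by metis
  have contraction: "l2_norm m f \<le> 1 / (K - \<mu>) * l2_norm m (?T f)" if "f \<in> laplacian_domain b m" for f
    by (rule coercive_operator_bound[OF bounded_well pos coercive that])
  have \<delta>: "?\<delta> y \<in> l2 m" for y by (rule finitely_supported_l2[OF finitely_supported_point])
  have injective: "f = (\<lambda>x. 0)" if "f \<in> laplacian_domain b m" "\<And>x. laplacian b m f x = \<mu> * f x" for f
    using not_eigenvalue that unfolding eigenvalue_def op_eigenspace_def by auto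
  have diff_zero_eq: "g = f" if "(\<lambda>x. f x + -1 * g x) = (\<lambda>x. 0)" for f g :: "'v \<Rightarrow> real"
    using that by (auto simp: fun_eq_iff)
  \<comment> \<open>\<open>S c\<close> is \<open>G\<close> applied to \<open>K c\<close> on \<open>B\<close>, extended by \<open>0\<close>.\<close>
  define S where "S c = (\<lambda>x. \<Sum>y\<in>B. K * c y * G (?\<delta> y) x)" for c :: "'v \<Rightarrow> real"
  have S_dom: "S c \<in> laplacian_domain b m" and S_T: "?T (S c) x = (if x \<in> B then K * c x else 0)" for c x
  proof -
    note * = laplacian_sum[of B "\<lambda>y. G (?\<delta> y)" "\<lambda>y. K * c y", OF B G(1)[OF \<delta>]]
    show "S c \<in> laplacian_domain b m" using * by (simp add: S_def)
    have "?T (S c) x = (\<Sum>y\<in>B. K * c y * ?T (G (?\<delta> y)) x)"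
      using * by (simp add: S_def sum_distrib_left distrib_left sum.distrib mult_ac)
    also have "\<dots> = (\<Sum>y\<in>B. K * c y * ?\<delta> y x)"
      using fun_cong[OF G(2)[OF \<delta>], of _ x] by simp
    also have "\<dots> = (if x \<in> B then K * c x else 0)"
      using B by (simp add: if_distrib[of "(*) _"] sum.delta cong: if_cong)
    finally show "?T (S c) x = (if x \<in> B then K * c x else 0)" .
  qed
  \<comment> \<open>If \<open>c\<close> agrees on \<open>B\<close> with the function \<open>u + S c\<close> that it produces, the well cancels.\<close>
  have solves: "laplacian b m (\<lambda>x. u x + 1 * S c x) x - \<mu> * (u x + 1 * S c x) = ?T u x"
    if u: "u \<in> laplacian_domain b m" and match: "\<And>x. x \<in> B \<Longrightarrow> u x + S c x = c x" for u c x
  proof -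
    have "laplacian b m (\<lambda>x. u x + 1 * S c x) x - \<mu> * (u x + 1 * S c x)
        = ?T u x + ?T (S c) x - well K B x * (u x + S c x)"
      unfolding laplacian_combination(2)[OF u S_dom] by (simp add: algebra_simps)
    also have "\<dots> = ?T u x" unfolding S_T using match[of x] by (simp add: well_def)
    finally show ?thesis .
  qed
  define a where "a y x = ?\<delta> y x - K * G (?\<delta> y) x" for y x
  have a_sum: "(\<Sum>y\<in>B. c y * a y x) = c x - S c x" if "x \<in> B" for c x
  proof -
    have "(\<Sum>y\<in>B. c y * a y x) = (\<Sum>y\<in>B. c y * ?\<delta> y x) - S c x"
      by (simp add: a_def S_def right_diff_distrib sum_subtractf mult_ac)
    then show ?thesis using B that by (simp add: if_distrib[of "(*) _"] sum.delta cong: if_cong)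
  qed
  have "\<exists>e. \<forall>d. \<forall>x\<in>B. (\<Sum>y\<in>B. (\<Sum>z\<in>B. d z * e z y) * a y x) = d x"
  proof (rule finite_linear_inverse[OF B])
    fix c assume c: "\<forall>x\<in>B. (\<Sum>y\<in>B. c y * a y x) = 0"
    then have match: "0 + S c x = c x" if "x \<in> B" for x using a_sum[OF that, of c] that by simp
    have "S c = (\<lambda>x. 0)"
    proof (rule injective[OF S_dom])
      fix x
      show "laplacian b m (S c) x = \<mu> * S c x"
        using solves[OF zero_laplacian_domain(1) match, of x] by (simp add: zero_laplacian_domain)
    qed
    then show "\<forall>y\<in>B. c y = 0" using match by simp
  qed
  then obtain e where e: "\<And>d x. x \<in> B \<Longrightarrow> (\<Sum>y\<in>B. (\<Sum>z\<in>B. d z * e z y) * a y x) = d x" by blast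
  \<comment> \<open>The values on \<open>B\<close> of the solution \<open>R h\<close> with right-hand side \<open>h\<close>.\<close>
  define c where "c h y = (\<Sum>z\<in>B. G h z * e z y)" for h y
  have match: "G h x + S (c h) x = c h x" if "x \<in> B" for h x
    using e[OF that, of "G h"] a_sum[OF that, of "c h"] by (simp add: c_def)
  define R where "R h = (\<lambda>x. G h x + 1 * S (c h) x)" for h
  have R: "R h \<in> laplacian_domain b m" "(\<lambda>x. laplacian b m (R h) x - \<mu> * R h x) = h" if h: "h \<in> l2 m" for h
  proof -
    show "R h \<in> laplacian_domain b m" unfolding R_def by (intro laplacian_combination G h S_dom)
    show "(\<lambda>x. laplacian b m (R h) x - \<mu> * R h x) = h"
      unfolding R_def
      using trans[OF solves[where u = "G h" and c = "c h", OF G(1)[OF h] match] fun_cong[OF G(2)[OF h]]]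
      by (rule ext)
  qed
  \<comment> \<open>\<open>R h\<close> is bounded by \<open>T (R h) = h + K 1\<^sub>B c\<close>, and \<open>c\<close> depends on \<open>h\<close> through the finitely many
    values of \<open>G h\<close> on \<open>B\<close>, each bounded by the norm of \<open>h\<close>.\<close>
  define C where "C = (\<Sum>y\<in>B. (\<Sum>z\<in>B. \<bar>e z y\<bar> / (K - \<mu>) / sqrt (m z))\<^sup>2 * m y)"
  have "0 \<le> C" unfolding C_def by (intro sum_nonneg) (simp add: less_imp_le m_pos)
  have R_bound: "l2_norm m (R h) \<le> 1 / (K - \<mu>) * sqrt (2 + 2 * K\<^sup>2 * C) * l2_norm m h" if h: "h \<in> l2 m" for h
  proof -
    let ?E = "\<lambda>y. \<Sum>z\<in>B. \<bar>e z y\<bar> / (K - \<mu>) / sqrt (m z)"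
    have Gh: "\<bar>G h z\<bar> \<le> l2_norm m h / (K - \<mu>) / sqrt (m z)" for z
    proof -
      have "sqrt (m z * (G h z)\<^sup>2) \<le> l2_norm m (G h)" unfolding l2_norm_def
        by (intro real_sqrt_le_mono vertex.point_mass_le form_domain_l2 laplacian_domain_form_domain G h)
      then have "sqrt (m z) * \<bar>G h z\<bar> \<le> l2_norm m h / (K - \<mu>)"
        using contraction[OF G(1)[OF h]] unfolding G(2)[OF h] by (simp add: real_sqrt_mult)
      then show ?thesis using m_pos[of z] by (subst pos_le_divide_eq) (auto simp: mult.commute)
    qed
    have c_bound: "(c h y)\<^sup>2 \<le> (l2_norm m h)\<^sup>2 * (?E y)\<^sup>2" for y
    proof -
      have "\<bar>c h y\<bar> \<le> (\<Sum>z\<in>B. \<bar>G h z\<bar> * \<bar>e z y\<bar>)"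
        unfolding c_def by (rule order_trans[OF sum_abs]) (simp add: abs_mult)
      also have "\<dots> \<le> (\<Sum>z\<in>B. l2_norm m h / (K - \<mu>) / sqrt (m z) * \<bar>e z y\<bar>)"
        by (intro sum_mono mult_right_mono Gh) simp
      also have "\<dots> = l2_norm m h * ?E y" by (simp add: sum_distrib_left mult_ac)
      finally have "\<bar>c h y\<bar>\<^sup>2 \<le> (l2_norm m h * ?E y)\<^sup>2" by (intro power_mono) auto
      then show ?thesis by (simp add: power_mult_distrib)
    qed
    let ?w = "\<lambda>x. if x \<in> B then K * c h x else 0"
    have wB: "{x. ?w x \<noteq> 0} \<subseteq> B" by auto
    have "?w \<in> finitely_supported"
      unfolding finitely_supported_def using finite_subset[OF wB B] by simp
    then have w_l2: "?w \<in> l2 m" by (rule finitely_supported_l2)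
    have "l2_inner m ?w ?w = (\<Sum>y\<in>B. K\<^sup>2 * ((c h y)\<^sup>2 * m y))"
      unfolding l2_inner_finite_sum[OF B wB] by (intro sum.cong) (auto simp: power2_eq_square mult_ac)
    also have "\<dots> \<le> (\<Sum>y\<in>B. K\<^sup>2 * ((l2_norm m h)\<^sup>2 * (?E y)\<^sup>2 * m y))"
      by (intro sum_mono mult_left_mono mult_right_mono c_bound) (auto simp: less_imp_le m_pos)
    also have "\<dots> = K\<^sup>2 * (l2_norm m h)\<^sup>2 * C" by (simp add: C_def sum_distrib_left mult_ac)
    finally have w: "l2_inner m ?w ?w \<le> K\<^sup>2 * (l2_norm m h)\<^sup>2 * C" .
    have T_eq: "?T (R h) = (\<lambda>x. h x + 1 * ?w x)"
    proof
      fix x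
      have "?T (R h) x = (laplacian b m (R h) x - \<mu> * R h x) + well K B x * R h x"
        by (simp add: left_diff_distrib)
      also have "\<dots> = h x + well K B x * R h x" using fun_cong[OF R(2)[OF h], of x] by simp
      also have "\<dots> = h x + 1 * ?w x" using match[of x h] by (simp add: well_def R_def)
      finally show "?T (R h) x = h x + 1 * ?w x" .
    qed
    have "(l2_norm m (?T (R h)))\<^sup>2 \<le> 2 * (l2_norm m h)\<^sup>2 + 2 * (K\<^sup>2 * (l2_norm m h)\<^sup>2 * C)"
      using vertex.l2_inner_combination_le[OF h w_l2, of 1] w
      unfolding T_eq vertex.l2_norm_squared by simp
    also have "\<dots> = (sqrt (2 + 2 * K\<^sup>2 * C) * l2_norm m h)\<^sup>2"
      using \<open>0 \<le> C\<close> by (simp add: power_mult_distrib algebra_simps)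
    finally have "l2_norm m (?T (R h)) \<le> sqrt (2 + 2 * K\<^sup>2 * C) * l2_norm m h"
      by (rule power2_le_imp_le) (use \<open>0 \<le> C\<close> in simp)
    then have "1 / (K - \<mu>) * l2_norm m (?T (R h)) \<le> 1 / (K - \<mu>) * (sqrt (2 + 2 * K\<^sup>2 * C) * l2_norm m h)"
      using pos by (intro mult_left_mono) auto
    then show ?thesis using contraction[OF R(1)[OF h]] by (simp add: mult.assoc)
  qed
  show ?thesis
  proof (rule resolvent_setI)
    show "\<exists>f\<in>laplacian_domain b m. (\<lambda>x. laplacian b m f x - \<mu> * f x) = h" if "h \<in> l2 m" for h
      using R[OF that] by blast
    fix f assume f: "f \<in> laplacian_domain b m"
    let ?h = "\<lambda>x. laplacian b m f x - \<mu> * f x"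
    have h: "?h \<in> l2 m"
      by (intro vertex.l2_diff vertex.l2_scale laplacian_weak f form_domain_l2 laplacian_domain_form_domain)
    have "(\<lambda>x. f x + -1 * R ?h x) = (\<lambda>x. 0)"
    proof (rule injective)
      note d = laplacian_combination[OF f R(1)[OF h], of "-1"]
      show "(\<lambda>x. f x + -1 * R ?h x) \<in> laplacian_domain b m" by (rule d)
      fix x
      show "laplacian b m (\<lambda>x. f x + -1 * R ?h x) x = \<mu> * (f x + -1 * R ?h x)"
        unfolding d(2) using fun_cong[OF R(2)[OF h], of x] by (simp add: algebra_simps)
    qed
    then have "l2_norm m (R ?h) = l2_norm m f" by (rule arg_cong[OF diff_zero_eq])
    then show "l2_norm m f \<le> 1 / (K - \<mu>) * sqrt (2 + 2 * K\<^sup>2 * C) * l2_norm m ?h"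
      using R_bound[OF h] by linarith
  qed
qed

text \<open>An eigenfunction that vanishes on \<open>B\<close> is \<open>0\<close>, since its energy is \<open>\<mu> < K\<close> times its squared norm.\<close>

lemma confining_eigenspace_finite_dimensional:
  assumes B: "finite B" and bound: "\<forall>\<phi>\<in>finitely_supported.
      K * l2_inner m \<phi> \<phi> \<le> energy b \<phi> \<phi> + K * (\<Sum>x\<in>B. (\<phi> x)\<^sup>2 * m x)"
    and "\<mu> < K"
  shows "finite_dimensional (op_eigenspace (laplacian_domain b m) (laplacian b m) \<mu>)"
proof (rule finite_dimensional_of_finite_restriction[OF B])
  show "(\<lambda>x. f x + t * g x) \<in> op_eigenspace (laplacian_domain b m) (laplacian b m) \<mu>"
    if "f \<in> op_eigenspace (laplacian_domain b m) (laplacian b m) \<mu>"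
      "g \<in> op_eigenspace (laplacian_domain b m) (laplacian b m) \<mu>" for f g t
    using that laplacian_combination[of f g t] by (auto simp: op_eigenspace_def algebra_simps)
  fix f assume "f \<in> op_eigenspace (laplacian_domain b m) (laplacian b m) \<mu>" and zero: "\<forall>x\<in>B. f x = 0"
  then have dom: "f \<in> laplacian_domain b m" and eq: "laplacian b m f = (\<lambda>x. \<mu> * f x)"
    by (auto simp: op_eigenspace_def)
  have fD: "f \<in> form_domain b m" using dom by (rule laplacian_domain_form_domain)
  have "energy b f f = \<mu> * l2_inner m f f"
    using laplacian_weak(2)[OF dom fD] unfolding eq by (simp add: vertex.l2_inner_scale_left)
  then have "(K - \<mu>) * l2_inner m f f \<le> 0"
    using confining_extend[OF B bound fD] zero by (simp add: left_diff_distrib)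
  then have "l2_inner m f f = 0"
    using \<open>\<mu> < K\<close> vertex.l2_inner_self_nonneg[of f] by (simp add: mult_le_0_iff)
  then show "f = (\<lambda>x. 0)" using form_domain_l2[OF fD] by (intro l2_inner_self_eq_0)
qed

theorem confining_discrete_spectrum:
  assumes "confining b m"
  shows "laplacian_spectrum b m = laplacian_disc_spectrum b m"
proof
  show "laplacian_disc_spectrum b m \<subseteq> laplacian_spectrum b m"
    by (auto simp: laplacian_disc_spectrum_def laplacian_spectrum_def op_disc_spectrum_def isolated_in_def)
  have obtain_B: "\<exists>B. finite B \<and> (\<forall>\<phi>\<in>finitely_supported.
      K * l2_inner m \<phi> \<phi> \<le> energy b \<phi> \<phi> + K * (\<Sum>x\<in>B. (\<phi> x)\<^sup>2 * m x))" if "0 \<le> K" for K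
    using assms that by (simp add: confining_def)
  have spectrum_eigenvalue: "eigenvalue \<mu>" if "\<mu> \<in> laplacian_spectrum b m" for \<mu>
  proof (rule ccontr)
    assume "\<not> eigenvalue \<mu>"
    moreover obtain B where B: "finite B" "\<forall>\<phi>\<in>finitely_supported.
      (\<bar>\<mu>\<bar> + 1) * l2_inner m \<phi> \<phi> \<le> energy b \<phi> \<phi> + (\<bar>\<mu>\<bar> + 1) * (\<Sum>x\<in>B. (\<phi> x)\<^sup>2 * m x)"
      using obtain_B[of "\<bar>\<mu>\<bar> + 1"] by auto
    ultimately show False
      using that confining_resolvent[OF B] by (auto simp: laplacian_spectrum_def op_spectrum_def)
  qed
  show "laplacian_spectrum b m \<subseteq> laplacian_disc_spectrum b m"
  proof
    fix \<mu> assume \<mu>: "\<mu> \<in> laplacian_spectrum b m"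
    let ?K = "\<bar>\<mu>\<bar> + 1"
    obtain B where B: "finite B" "\<forall>\<phi>\<in>finitely_supported.
      ?K * l2_inner m \<phi> \<phi> \<le> energy b \<phi> \<phi> + ?K * (\<Sum>x\<in>B. (\<phi> x)\<^sup>2 * m x)"
      using obtain_B[of ?K] by auto
    let ?S = "laplacian_spectrum b m \<inter> {..<?K}"
    have "finite ?S"
    proof (rule ccontr)
      assume "infinite ?S"
      then obtain M where M: "finite M" "card M = Suc (card B)" "M \<subseteq> ?S"
        using infinite_arbitrarily_large by blast
      then have "card M \<le> card B"
        using spectrum_eigenvalue by (intro confining_card_eigenvalues[OF B M(1)]) auto
      then show False using M(2) by simp
    qed
    then have "open ({..<?K} - (?S - {\<mu>}))"
      by (intro open_Diff finite_imp_closed) auto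
    moreover have "({..<?K} - (?S - {\<mu>})) \<inter> laplacian_spectrum b m = {\<mu>}" using \<mu> by auto
    ultimately have "\<mu> isolated_in laplacian_spectrum b m" using \<mu> unfolding isolated_in_def by blast
    moreover have "finite_dimensional (op_eigenspace (laplacian_domain b m) (laplacian b m) \<mu>)"
      by (rule confining_eigenspace_finite_dimensional[OF B]) simp
    ultimately show "\<mu> \<in> laplacian_disc_spectrum b m"
      using spectrum_eigenvalue[OF \<mu>]
      by (simp add: laplacian_disc_spectrum_def op_disc_spectrum_def eigenvalue_def laplacian_spectrum_def)
  qed
qed

end

section \<open>Comparison with a weakly spherically symmetric graph\<close>

context weighted_graph
begin

text \<open>Some vertex of each sphere has a neighbour in the next one. Under weak spherical symmetry this
  makes the common value of \<open>kappa_plus\<close> on the sphere positive.\<close>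

lemma kappa_plus_pos: "\<exists>x. graph_dist b x0 x = r \<and> 0 < kappa_plus b m x0 x"
proof -
  obtain y where y: "graph_dist b x0 y = Suc r" using sphere_nonempty by blast
  then obtain x where x: "graph_dist b x0 x = r" "b x y > 0" using graph_dist_predecessor by blast
  have "b x y \<le> kappa_plus b m x0 x * m x"
    unfolding kappa_plus_mass x(1) using y finite_sphere b_nonneg by (intro member_le_sum) auto
  then have "0 < kappa_plus b m x0 x * m x" using x(2) by linarith
  then show ?thesis using x(1) m_pos[of x] by (auto simp: zero_less_mult_iff)
qed

lemma kappa_sym_eq:
  assumes "weakly_spherically_symmetric b m x0"
  shows "kappa_plus_sym b m x0 (graph_dist b x0 x) = kappa_plus b m x0 x"
    "kappa_minus_sym b m x0 (graph_dist b x0 x) = kappa_minus b m x0 x"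
proof -
  have "(THE k. \<forall>y\<in>{y. graph_dist b x0 y = graph_dist b x0 x}. g y = k) = g x"
    if "\<And>y. graph_dist b x0 y = graph_dist b x0 x \<Longrightarrow> g y = g x" for g :: "'v \<Rightarrow> real"
  proof (rule the_equality)
    show "\<forall>y\<in>{y. graph_dist b x0 y = graph_dist b x0 x}. g y = g x" using that by blast
    show "k = g x" if "\<forall>y\<in>{y. graph_dist b x0 y = graph_dist b x0 x}. g y = k" for k
      using bspec[OF that, of x] by simp
  qed
  then show "kappa_plus_sym b m x0 (graph_dist b x0 x) = kappa_plus b m x0 x"
    "kappa_minus_sym b m x0 (graph_dist b x0 x) = kappa_minus b m x0 x"
    using assms unfolding kappa_plus_sym_def kappa_minus_sym_def graph_sphere_eq
      weakly_spherically_symmetric_def by blast+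
qed

lemma kappa_sym_sign:
  assumes "weakly_spherically_symmetric b m x0"
  shows "0 < kappa_plus_sym b m x0 r" "0 \<le> kappa_minus_sym b m x0 r"
proof -
  obtain x where "graph_dist b x0 x = r" "0 < kappa_plus b m x0 x" using kappa_plus_pos by blast
  then show "0 < kappa_plus_sym b m x0 r" "0 \<le> kappa_minus_sym b m x0 r"
    using kappa_sym_eq[OF assms, of x] kappa_nonneg(2)[of x0 x] by auto
qed

definition sphere_volume :: "'v \<Rightarrow> nat \<Rightarrow> real" where
  "sphere_volume x0 r = (\<Sum>x | graph_dist b x0 x = r. m x)"

lemma sphere_volume_pos: "0 < sphere_volume x0 r"
  unfolding sphere_volume_def using sphere_nonempty[of x0 r] finite_sphere m_pos by (intro sum_pos) auto

lemma ball_volume_0: "ball_volume b m x0 0 = sphere_volume x0 0"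
  by (simp add: ball_volume_def sphere_volume_def graph_ball_def graph_sphere_def)

lemma ball_volume_Suc: "ball_volume b m x0 (Suc r) = ball_volume b m x0 r + sphere_volume x0 (Suc r)"
proof -
  have ball: "graph_ball b x0 n = {x. graph_dist b x0 x \<le> n}" for n
    by (auto simp: graph_ball_def graph_sphere_eq)
  have "{x. graph_dist b x0 x \<le> Suc r} = {x. graph_dist b x0 x \<le> r} \<union> {x. graph_dist b x0 x = Suc r}"
    by auto
  then show ?thesis unfolding ball_volume_def ball sphere_volume_def
    using finite_ball[of x0 r] finite_sphere[of x0 "Suc r"]
    by (simp only:) (rule sum.union_disjoint, auto)
qed

lemma ball_volume_pos: "0 < ball_volume b m x0 r"
proof (induction r)
  case 0 show ?case using sphere_volume_pos[of x0 0] by (simp add: ball_volume_0)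
next
  case (Suc r) then show ?case using sphere_volume_pos[of x0 "Suc r"] by (simp add: ball_volume_Suc)
qed

lemma ball_boundary_outer:
  assumes "weakly_spherically_symmetric b m x0"
  shows "ball_boundary b m x0 r = kappa_plus_sym b m x0 r * sphere_volume x0 r"
  unfolding ball_boundary_def graph_sphere_eq sphere_volume_def sum_distrib_left
  by (intro sum.cong) (auto simp: kappa_sym_eq[OF assms, symmetric])

text \<open>Count the edges between two successive spheres from the outer one.\<close>

lemma ball_boundary_inner:
  assumes "weakly_spherically_symmetric b m x0"
  shows "ball_boundary b m x0 r = kappa_minus_sym b m x0 (Suc r) * sphere_volume x0 (Suc r)"
proof -
  let ?S = "\<lambda>n. {x. graph_dist b x0 x = n}"
  have "ball_boundary b m x0 r = (\<Sum>x\<in>?S r. \<Sum>y\<in>?S (Suc r). b x y)"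
    unfolding ball_boundary_def graph_sphere_eq kappa_plus_mass by (intro sum.cong) auto
  also have "\<dots> = (\<Sum>y\<in>?S (Suc r). \<Sum>x\<in>?S r. b y x)"
    by (subst sum.swap) (simp add: b_sym)
  also have "\<dots> = (\<Sum>y\<in>?S (Suc r). kappa_minus b m x0 y * m y)"
    unfolding kappa_minus_mass by (intro sum.cong) auto
  also have "\<dots> = kappa_minus_sym b m x0 (Suc r) * sphere_volume x0 (Suc r)"
    unfolding sphere_volume_def sum_distrib_left
    by (intro sum.cong) (auto simp: kappa_sym_eq[OF assms, symmetric])
  finally show ?thesis .
qed

lemma kappa_minus_sym_0:
  assumes "weakly_spherically_symmetric b m x0"
  shows "kappa_minus_sym b m x0 0 = 0"
proof -
  have "kappa_minus b m x0 x0 * m x0 = 0"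
    unfolding kappa_minus_mass using graph_dist_eq_0_iff[of x0 x0] by simp
  then show ?thesis
    using kappa_sym_eq(2)[OF assms, of x0] graph_dist_eq_0_iff[of x0 x0] m_pos[of x0] by simp
qed

lemma ball_boundary_pos:
  assumes "weakly_spherically_symmetric b m x0"
  shows "0 < ball_boundary b m x0 r"
  unfolding ball_boundary_outer[OF assms] using kappa_sym_sign(1)[OF assms] sphere_volume_pos by simp

text \<open>A radial function with drops \<open>q r\<close> has Laplacian \<open>1\<close>: the flux \<open>\<partial>B(r) q(r)\<close> out of each ball is the volume of the
  ball, so the net flux out of a sphere is its volume.\<close>

lemma volume_ratio_equation:
  assumes sym: "weakly_spherically_symmetric b m x0"
  defines "q \<equiv> \<lambda>r. ball_volume b m x0 r / ball_boundary b m x0 r"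
  shows "kappa_plus_sym b m x0 r * q r - kappa_minus_sym b m x0 r * q (r - 1) = 1"
proof -
  have plus: "kappa_plus_sym b m x0 r * q r = ball_volume b m x0 r / sphere_volume x0 r"
    using kappa_sym_sign(1)[OF sym, of r] by (simp add: q_def ball_boundary_outer[OF sym])
  show ?thesis
  proof (cases r)
    case 0
    then show ?thesis using plus sphere_volume_pos[of x0 0]
      by (simp add: kappa_minus_sym_0[OF sym] ball_volume_0)
  next
    case (Suc n)
    have "kappa_minus_sym b m x0 r \<noteq> 0"
      using ball_boundary_pos[OF sym, of n] by (auto simp: ball_boundary_inner[OF sym] Suc)
    then have "kappa_minus_sym b m x0 r * q (r - 1) = ball_volume b m x0 n / sphere_volume x0 r"
      by (simp add: q_def ball_boundary_inner[OF sym] Suc)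
    then show ?thesis using plus sphere_volume_pos[of x0 r]
      by (simp add: Suc ball_volume_Suc add_divide_distrib)
  qed
qed

lemma kappa_sym_comparison:
  assumes "weakly_spherically_symmetric b m x0"
  shows "kappa_plus_sym b m x0 (graph_dist b x0 x) \<le> kappa_plus b m x0 x"
    "kappa_plus b m x0 x \<le> kappa_plus_sym b m x0 (graph_dist b x0 x)"
    "kappa_minus_sym b m x0 (graph_dist b x0 x) \<le> kappa_minus b m x0 x"
    "kappa_minus b m x0 x \<le> kappa_minus_sym b m x0 (graph_dist b x0 x)"
  by (simp_all add: kappa_sym_eq[OF assms])

text \<open>The tails of the series \<open>q\<close> form a positive decreasing radial function with Laplacian at least
  \<open>1\<close>, so Picone's inequality applies with the reciprocal tail as weight.\<close>

lemma radial_hardy_inequality: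
  assumes stronger: "\<And>x. kp (graph_dist b x0 x) \<le> kappa_plus b m x0 x"
      "\<And>x. kappa_minus b m x0 x \<le> km (graph_dist b x0 x)"
    and q: "\<And>r. 0 < q r" "q sums a" and eq: "\<And>r. kp r * q r - km r * q (r - 1) = 1"
    and km0: "km 0 = 0"
    and "finite K" and supp: "{x. \<phi> x \<noteq> 0} \<subseteq> K"
  shows "(\<Sum>x\<in>K. 1 / (a - sum q {..<graph_dist b x0 x}) * (\<phi> x)\<^sup>2 * m x) \<le> energy b \<phi> \<phi>"
proof -
  let ?v = "\<lambda>r. a - sum q {..<r}"
  have pos: "0 < ?v r" for r
    using sum_less_suminf[of q r] q sums_unique[OF q(2)] sums_summable[OF q(2)] by simp
  have drop: "?v r - ?v (Suc r) = q r" for r by simp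
  have "1 / ?v r * ?v r \<le> kp r * (?v r - ?v (Suc r)) + km r * (?v r - ?v (r - 1))" for r
  proof -
    have "km r * (?v r - ?v (r - 1)) = - (km r * q (r - 1))" by (cases r) (simp_all add: km0)
    moreover have "1 / ?v r * ?v r = 1" using pos[of r] by simp
    ultimately show ?thesis unfolding drop using eq[of r] by linarith
  qed
  moreover have "?v (Suc r) \<le> ?v r" for r using q(1)[of r] by simp
  ultimately show ?thesis
    using radial_supersolution_bound[where u = ?v and W = "\<lambda>r. 1 / ?v r" and kp = kp and km = km,
        OF stronger pos _ _ \<open>finite K\<close> supp] by blast
qed

text \<open>The weights are at least \<open>1 / a\<close>, since each tail is at most the full sum \<open>a\<close>, and they exceed any
  \<open>K\<close> outside a ball, since the tails tend to \<open>0\<close>.\<close>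

lemma radial_hardy_consequences:
  assumes stronger: "\<And>x. kp (graph_dist b x0 x) \<le> kappa_plus b m x0 x"
      "\<And>x. kappa_minus b m x0 x \<le> km (graph_dist b x0 x)"
    and q: "\<And>r. 0 < q r" "q sums a" and eq: "\<And>r. kp r * q r - km r * q (r - 1) = 1"
    and km0: "km 0 = 0"
  shows "rayleigh_bound b m (1 / a)" "confining b m"
proof -
  let ?d = "graph_dist b x0"
  define v where "v r = a - sum q {..<r}" for r
  have pos: "0 < v r" for r
    using sum_less_suminf[of q r] q sums_unique[OF q(2)] sums_summable[OF q(2)] by (simp add: v_def)
  have le_a: "v r \<le> a" for r unfolding v_def using q(1) by (simp add: sum_nonneg less_imp_le)
  have "(\<lambda>r. sum q {..<r}) \<longlonglongrightarrow> a" using q(2) by (simp add: sums_def)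
  then have v_lim: "v \<longlonglongrightarrow> 0" unfolding v_def using tendsto_diff[OF tendsto_const[of a]] by fastforce
  have supp_fin: "finite {x. \<phi> x \<noteq> 0}" if "\<phi> \<in> finitely_supported" for \<phi> :: "'v \<Rightarrow> real"
    using that by (simp add: finitely_supported_def)
  have norm: "c * l2_inner m \<phi> \<phi> = (\<Sum>x | \<phi> x \<noteq> 0. c * (\<phi> x)\<^sup>2 * m x)" if "\<phi> \<in> finitely_supported" for \<phi> c
    unfolding l2_inner_finite_sum[OF supp_fin[OF that] subset_refl] sum_distrib_left
    by (simp add: power2_eq_square mult.assoc)
  have hardy: "(\<Sum>x | \<phi> x \<noteq> 0. 1 / v (?d x) * (\<phi> x)\<^sup>2 * m x) \<le> energy b \<phi> \<phi>" if "\<phi> \<in> finitely_supported" for \<phi>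
    unfolding v_def
    by (rule radial_hardy_inequality[where kp = kp and km = km, OF stronger q eq km0 supp_fin[OF that] subset_refl])
  have weight: "0 \<le> (\<phi> x)\<^sup>2 * m x" for \<phi> x using m_pos[of x] by simp
  show "rayleigh_bound b m (1 / a)" unfolding rayleigh_bound_def
  proof
    fix \<phi> :: "'v \<Rightarrow> real" assume fs: "\<phi> \<in> finitely_supported"
    have "1 / a * (\<phi> x)\<^sup>2 * m x \<le> 1 / v (?d x) * (\<phi> x)\<^sup>2 * m x" for x
      using pos[of "?d x"] le_a[of "?d x"] weight[of \<phi> x] unfolding mult.assoc
      by (intro mult_right_mono divide_left_mono) auto
    then show "1 / a * l2_inner m \<phi> \<phi> \<le> energy b \<phi> \<phi>"
      unfolding norm[OF fs] by (intro order_trans[OF sum_mono hardy[OF fs]])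
  qed
  show "confining b m" unfolding confining_def
  proof (intro allI impI)
    fix K :: real assume K: "0 \<le> K"
    have "0 < 1 / (K + 1)" using K by simp
    from order_tendstoD(2)[OF v_lim this] obtain R where R: "\<And>r. r \<ge> R \<Longrightarrow> v r < 1 / (K + 1)"
      by (auto simp: eventually_sequentially)
    let ?B = "{x. ?d x \<le> R}"
    have "K * l2_inner m \<phi> \<phi> \<le> energy b \<phi> \<phi> + K * (\<Sum>x\<in>?B. (\<phi> x)\<^sup>2 * m x)"
      if fs: "\<phi> \<in> finitely_supported" for \<phi>
    proof -
      have "K * (\<phi> x)\<^sup>2 * m x \<le> 1 / v (?d x) * (\<phi> x)\<^sup>2 * m x + (if x \<in> ?B then K * ((\<phi> x)\<^sup>2 * m x) else 0)" for x
      proof (cases "x \<in> ?B")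
        case True
        then show ?thesis using pos[of "?d x"] weight[of \<phi> x] by (simp add: mult.assoc)
      next
        case False
        then have "v (?d x) < 1 / (K + 1)" by (intro R) simp
        then have "K \<le> 1 / v (?d x)" using pos[of "?d x"] K by (simp add: field_simps)
        from mult_right_mono[OF this weight[of \<phi> x]] show ?thesis using False by (simp add: mult.assoc)
      qed
      then have "K * l2_inner m \<phi> \<phi> \<le> (\<Sum>x | \<phi> x \<noteq> 0. 1 / v (?d x) * (\<phi> x)\<^sup>2 * m x)
          + (\<Sum>x | \<phi> x \<noteq> 0. if x \<in> ?B then K * ((\<phi> x)\<^sup>2 * m x) else 0)"
        unfolding norm[OF fs] sum.distrib[symmetric] by (intro sum_mono)
      also have "(\<Sum>x | \<phi> x \<noteq> 0. if x \<in> ?B then K * ((\<phi> x)\<^sup>2 * m x) else 0) = K * (\<Sum>x\<in>?B. (\<phi> x)\<^sup>2 * m x)"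
        unfolding sum_distrib_left using supp_fin[OF fs] finite_ball
        by (intro sum.mono_neutral_cong) auto
      finally show ?thesis using hardy[OF fs] by linarith
    qed
    then show "\<exists>B. finite B \<and> (\<forall>\<phi>\<in>finitely_supported.
        K * l2_inner m \<phi> \<phi> \<le> energy b \<phi> \<phi> + K * (\<Sum>x\<in>B. (\<phi> x)\<^sup>2 * m x))"
      using finite_ball by blast
  qed
qed

end

text \<open>The first graph is weaker and the second is stronger than the radial curvatures \<open>kp\<close> and \<open>km\<close>. For each
  \<open>\<mu> \<ge> 0\<close> below the first bottom, the first graph makes the radial eigenfunction positive and the second one
  turns it into a lower bound. Negative \<open>\<mu>\<close> lie below every spectrum.\<close>

lemma spectrum_bottom_mono_radial:
  assumes "weighted_graph b m" "weighted_graph b' m'"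
    and weaker: "\<And>x. kappa_plus b m x0 x \<le> kp (graph_dist b x0 x)"
      "\<And>x. km (graph_dist b x0 x) \<le> kappa_minus b m x0 x"
    and stronger: "\<And>x. kp (graph_dist b' x0' x) \<le> kappa_plus b' m' x0' x"
      "\<And>x. kappa_minus b' m' x0' x \<le> km (graph_dist b' x0' x)"
    and kp: "\<And>r. 0 < kp r" and km: "\<And>r. 0 \<le> km r"
  shows "spectrum_bottom b m \<le> spectrum_bottom b' m'"
proof (rule dense_le)
  interpret weighted_graph b m by fact
  interpret G': weighted_graph b' m' by fact
  fix \<mu> assume \<mu>: "\<mu> < spectrum_bottom b m"
  show "\<mu> \<le> spectrum_bottom b' m'"
  proof (cases "0 \<le> \<mu>")
    case True
    have "rayleigh_bound b m (spectrum_bottom b m)" by (simp add: rayleigh_bound_iff)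
    then have "0 < radial_eigenfunction kp km \<mu> r" for r
      by (rule radial_eigenfunction_pos[where kp = kp and km = km, OF weaker kp km True \<mu>])
    then have "rayleigh_bound b' m' \<mu>"
      by (rule G'.rayleigh_bound_of_radial_eigenfunction[where kp = kp and km = km, OF stronger kp km True])
    then show ?thesis by (simp add: G'.rayleigh_bound_iff)
  next
    case False then show ?thesis using G'.spectrum_bottom_nonneg by linarith
  qed
qed

lemma stronger_curvature_growthD:
  assumes "stronger_curvature_growth b m x0 bs ms os"
  shows "kappa_plus_sym bs ms os (graph_dist b x0 x) \<le> kappa_plus b m x0 x"
    "kappa_minus b m x0 x \<le> kappa_minus_sym bs ms os (graph_dist b x0 x)"
  using assms by (auto simp: stronger_curvature_growth_def graph_sphere_def)

lemma weaker_curvature_growthD: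
  assumes "weaker_curvature_growth b m x0 bs ms os"
  shows "kappa_plus b m x0 x \<le> kappa_plus_sym bs ms os (graph_dist b x0 x)"
    "kappa_minus_sym bs ms os (graph_dist b x0 x) \<le> kappa_minus b m x0 x"
  using assms by (auto simp: weaker_curvature_growth_def graph_sphere_def)

theorem theorem4:
  fixes b :: "'v \<Rightarrow> 'v \<Rightarrow> real" and m :: "'v \<Rightarrow> real" and x0 :: 'v
    and bs :: "'w \<Rightarrow> 'w \<Rightarrow> real" and ms :: "'w \<Rightarrow> real" and os :: 'w
  assumes "weighted_graph b m"
    and "weighted_graph bs ms"
    and "weakly_spherically_symmetric bs ms os"
  shows "(stronger_curvature_growth b m x0 bs ms os \<longrightarrow>
            spectrum_bottom b m \<ge> spectrum_bottom bs ms) \<and>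
         (weaker_curvature_growth b m x0 bs ms os \<longrightarrow>
            spectrum_bottom b m \<le> spectrum_bottom bs ms) \<and>
         (\<forall>a. (\<lambda>r. ball_volume bs ms os r / ball_boundary bs ms os r) sums a \<longrightarrow>
            stronger_curvature_growth b m x0 bs ms os \<longrightarrow>
            spectrum_bottom b m \<ge> 1 / a \<and> laplacian_spectrum b m = laplacian_disc_spectrum b m)"
proof (intro conjI allI impI)
  interpret weighted_graph b m by fact
  interpret sym: weighted_graph bs ms by fact
  let ?kp = "kappa_plus_sym bs ms os" and ?km = "kappa_minus_sym bs ms os"
  note sym = \<open>weakly_spherically_symmetric bs ms os\<close>
  note compare = sym.kappa_sym_comparison[OF sym] and sign = sym.kappa_sym_sign[OF sym]
  show "spectrum_bottom bs ms \<le> spectrum_bottom b m" if "stronger_curvature_growth b m x0 bs ms os"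
    by (rule spectrum_bottom_mono_radial[where kp = ?kp and km = ?km,
        OF assms(2,1) compare(2,3) stronger_curvature_growthD[OF that] sign])
  show "spectrum_bottom b m \<le> spectrum_bottom bs ms" if "weaker_curvature_growth b m x0 bs ms os"
    by (rule spectrum_bottom_mono_radial[where kp = ?kp and km = ?km,
        OF assms(1,2) weaker_curvature_growthD[OF that] compare(1,4) sign])
  fix a assume sums: "(\<lambda>r. ball_volume bs ms os r / ball_boundary bs ms os r) sums a"
    and stronger: "stronger_curvature_growth b m x0 bs ms os"
  have "0 < ball_volume bs ms os r / ball_boundary bs ms os r" for r
    using sym.ball_volume_pos sym.ball_boundary_pos[OF sym] by simp
  note * = radial_hardy_consequences[where kp = ?kp and km = ?km, OF stronger_curvature_growthD[OF stronger] this sums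
      sym.volume_ratio_equation[OF sym] sym.kappa_minus_sym_0[OF sym]]
  show "1 / a \<le> spectrum_bottom b m" using *(1) by (simp add: rayleigh_bound_iff)
  show "laplacian_spectrum b m = laplacian_disc_spectrum b m"
    using *(2) by (rule confining_discrete_spectrum)
qed

end
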